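(* Let $q$ be a prime power and let $m,l,k$ be positive integers satisfying $3\le k\le \min\{m+1,l\}$. Let $w\in\{0,1\}$ and, for each $2\le r\le k-1$ and each positive divisor $u$ of $\gcd(r+1,l)$, let $w_{r,u}$ be an integer with $0\le w_{r,u}\le n_{r+1,u}^l$. Then there exists a simple $(ml,l,k,\lambda)_q$-GDD on $\mathrm{GF}(q)^{ml}$ whose set of groups is the Desarguesian $l$-spread $\mathcal G$ and which admits $\mathrm{GL}(m,q^l)$ as an automorphism group, where $$\lambda=\sum_{r=2}^{k-1}\ \sum_{u\mid\gcd(r+1,l)} w_{r,u}\,\frac{(q^k-1)(q^k-q)\prod_{j=2}^{k-2}(q^{ml}-q^{jl})}{(q^{u}-1)\prod_{j=r+1}^{k-1}(q^k-q^j)}\;+\;w\,q^{(l-1)\left(\binom{k}{2}-1\right)}\prod_{j=2}^{k-1}\frac{q^{(m-j)l}-1}{q^{k-j}-1}.$$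
   Context: Empty products equal $1$. An $i$-subspace is an $i$-dimensional $\mathrm{GF}(q)$-subspace. A $(v,g,k,\lambda)_q$-GDD ($q$-analog of a group divisible design) is a triple $(V,\mathcal G,\mathcal B)$ where $V$ is a $v$-dimensional vector space over $\mathrm{GF}(q)$, $\mathcal G$ (the set of groups) is a set of $g$-subspaces partitioning the set of $1$-subspaces of $V$, and $\mathcal B$ (the blocks) is a collection, possibly with repetition, of $k$-subspaces of $V$ such that: (i) $\dim_{\mathrm{GF}(q)}(B\cap W)\le 1$ for all $W\in\mathcal G$, $B\in\mathcal B$; (ii) every $2$-subspace of $V$ not contained in any group is contained in exactly $\lambda$ blocks. It is simple if $\mathcal B$ has no repeated blocks. It admits a subgroup of $\mathrm{GL}(V)$ as an automorphism group if every element of that subgroup preserves $\mathcal B$ (and $\mathcal G$). Identify $\mathrm{GF}(q)^{ml}$ with $\mathrm{GF}(q^l)^m$ regarded as a $\mathrm{GF}(q)$-space; $\mathrm{GL}(m,q^l)$ acts on it by $\mathrm{GF}(q^l)$-linear maps. The Desarguesian $l$-spread $\mathcal G$ is the set of all $1$-dimensional $\mathrm{GF}(q^l)$-subspaces, regarded as $l$-subspaces over $\mathrm{GF}(q)$. For $u\mid\gcd(d,l)$, $$n_{d,u}^l=\frac{q^u-1}{q^l-1}\sum_{t:\,u\mid t\mid\gcd(d,l)}\mu(t/u)\begin{bmatrix} l/t\\ d/t\end{bmatrix}_{q^t},$$ where $\mu$ is the Möbius function and $\begin{bmatrix} a\\ b\end{bmatrix}_{Q}$ is the Gaussian binomial coefficient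 (the number of $b$-dimensional subspaces of a space of dimension $a$ over the field with $Q$ elements). It equals the number of orbits of the multiplicative group $H=\mathrm{GF}(q^l)^*$, acting by multiplication on the $d$-dimensional $\mathrm{GF}(q)$-subspaces of $\mathrm{GF}(q^l)$, for which the stabilizer of a subspace in the orbit is $\mathrm{GF}(q^u)^*$. *)

theory Defs
  imports
    "HOL-Analysis.Cartesian_Space"
    "HOL-Library.Multiset"
    "HOL-Library.Disjoint_Sets"
    "HOL-Computational_Algebra.Squarefree"
    "HOL-Number_Theory.Prime_Powers"
begin

definition moebius :: "nat \<Rightarrow> int" where
  "moebius n = (if squarefree n then (- 1) ^ card (prime_factors n) else 0)"

text \<open>For \<open>b > a\<close> the factor with \<open>i = a\<close> vanishes. The lemma \<open>card_subspaces\<close> below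
  shows that this number counts subspaces.\<close>
definition gauss_binomial :: "nat \<Rightarrow> nat \<Rightarrow> nat \<Rightarrow> real" where
  "gauss_binomial Q a b = (\<Prod>i<b. (real Q ^ (a - i) - 1) / (real Q ^ (i + 1) - 1))"

text \<open>The number \<open>n\<^sup>l\<^bsub>d,u\<^esub>\<close> over \<open>GF(q)\<close>, for \<open>u dvd gcd d l\<close>.\<close>
definition orbit_number :: "nat \<Rightarrow> nat \<Rightarrow> nat \<Rightarrow> nat \<Rightarrow> real" where
  "orbit_number q l d u =
     (real q ^ u - 1) / (real q ^ l - 1) *
     (\<Sum>t | u dvd t \<and> t dvd gcd d l.
        of_int (moebius (t div u)) * gauss_binomial (q ^ t) (l div t) (d div t))"

text \<open>The ambient vector space \<open>V\<close> is the whole type \<open>'b\<close>, with scalars in the field \<open>'a\<close>.\<close>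
locale gf_vector_space = vector_space scale
  for scale :: "'a::{field, finite} \<Rightarrow> 'b::{ab_group_add, finite} \<Rightarrow> 'b"
begin

definition i_subspaces :: "nat \<Rightarrow> 'b set set" where
  "i_subspaces i = {S. subspace S \<and> dim S = i}"

text \<open>The parameters are \<open>(v,g,k,\<lambda>)\<^sub>q\<close>. A group \<open>W\<close> is identified with the set of
  1-subspaces that it contains; blocks form a multiset, so they may be repeated.\<close>
definition q_gdd ::
  "nat \<Rightarrow> nat \<Rightarrow> nat \<Rightarrow> nat \<Rightarrow> nat \<Rightarrow> 'b set set \<Rightarrow> 'b set multiset \<Rightarrow> bool" where
  "q_gdd q v g k lam \<G> \<B> \<longleftrightarrow>
     CARD('a) = q \<and> dim (UNIV :: 'b set) = v \<and>
     \<G> \<subseteq> i_subspaces g \<and>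
     partition_on (i_subspaces 1) ((\<lambda>W. {P \<in> i_subspaces 1. P \<subseteq> W}) ` \<G>) \<and>
     set_mset \<B> \<subseteq> i_subspaces k \<and>
     (\<forall>W\<in>\<G>. \<forall>B\<in>#\<B>. dim (B \<inter> W) \<le> 1) \<and>
     (\<forall>T\<in>i_subspaces 2. (\<forall>W\<in>\<G>. \<not> T \<subseteq> W) \<longrightarrow> size {#B \<in># \<B>. T \<subseteq> B#} = lam)"

definition GL_maps :: "('b \<Rightarrow> 'b) set" where
  "GL_maps = {f. Vector_Spaces.linear scale scale f \<and> bij f}"

definition admits_automorphism_group ::
  "('b \<Rightarrow> 'b) set \<Rightarrow> 'b set set \<Rightarrow> 'b set multiset \<Rightarrow> bool" where
  "admits_automorphism_group \<Gamma> \<G> \<B> \<longleftrightarrow>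
     \<Gamma> \<subseteq> GL_maps \<and> id \<in> \<Gamma> \<and> (\<forall>f\<in>\<Gamma>. \<forall>g\<in>\<Gamma>. f \<circ> g \<in> \<Gamma>) \<and> (\<forall>f\<in>\<Gamma>. inv f \<in> \<Gamma>) \<and>
     (\<forall>f\<in>\<Gamma>. image_mset ((`) f) \<B> = \<B> \<and> (`) f ` \<G> = \<G>)"

end

definition simple_blocks :: "'b set multiset \<Rightarrow> bool" where
  "simple_blocks \<B> \<longleftrightarrow> (\<forall>B. count \<B> B \<le> 1)"

text \<open>Embedding of \<open>GF(q)\<close> in \<open>GF(q\<^sup>l)\<close>, by which \<open>GF(q\<^sup>l)\<^sup>m\<close> becomes a \<open>GF(q)\<close>-space.\<close>
definition field_embedding :: "('q::field \<Rightarrow> 'f::field) \<Rightarrow> bool" where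
  "field_embedding h \<longleftrightarrow>
     h 1 = 1 \<and> (\<forall>x y. h (x + y) = h x + h y) \<and> (\<forall>x y. h (x * y) = h x * h y)"

definition restricted_scale ::
  "('q::field \<Rightarrow> 'f::field) \<Rightarrow> 'q \<Rightarrow> 'f ^ 'm::finite \<Rightarrow> 'f ^ 'm" where
  "restricted_scale h c x = h c *s x"

lemma gf_vector_space_restricted_scale:
  assumes "field_embedding h"
  shows "gf_vector_space
    (restricted_scale h :: 'q::{field, finite} \<Rightarrow> 'f::{field, finite} ^ 'm::finite \<Rightarrow> 'f ^ 'm)"
  using assms
  by unfold_locales
     (simp_all add: restricted_scale_def field_embedding_def vec.scale_right_distrib
       vec.scale_left_distrib)

definition desarguesian_spread :: "('f::field ^ 'm::finite) set set" where
  "desarguesian_spread = {W. vec.subspace W \<and> vec.dim W = 1}"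

definition GL_action :: "('f::field ^ 'm::finite \<Rightarrow> 'f ^ 'm) set" where
  "GL_action = {(*v) A | A :: 'f ^ 'm ^ 'm. invertible A}"

context gf_vector_space
begin

lemma card_span_independent:
  assumes "finite B" "independent B"
  shows "card (span B) = CARD('a) ^ card B"
  using assms
proof (induction B rule: finite_induct)
  case empty
  then show ?case by simp
next
  case (insert a B)
  have ind: "independent B" and a: "a \<notin> span B"
    using insert.prems insert.hyps independent_insert by auto
  let ?f = "\<lambda>(c, x). scale c a + x"
  have img: "span (insert a B) = ?f ` (UNIV \<times> span B)"
  proof
    show "span (insert a B) \<subseteq> ?f ` (UNIV \<times> span B)"
    proof
      fix x assume "x \<in> span (insert a B)"
      then obtain c where c: "x - scale c a \<in> span B"
        by (auto simp: span_insert)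
      then show "x \<in> ?f ` (UNIV \<times> span B)"
        by (intro image_eqI[where x = "(c, x - scale c a)"]) auto
    qed
    show "?f ` (UNIV \<times> span B) \<subseteq> span (insert a B)"
    proof clarify
      fix c x assume "x \<in> span B"
      then have "(scale c a + x) - scale c a \<in> span B" by simp
      then show "scale c a + x \<in> span (insert a B)"
        unfolding span_insert by blast
    qed
  qed
  have inj: "inj_on ?f (UNIV \<times> span B)"
  proof (rule inj_onI, clarsimp)
    fix c x d y
    assume x: "x \<in> span B" and y: "y \<in> span B" and e: "scale c a + x = scale d a + y"
    have "scale (c - d) a = y - x"
      using e by (simp add: scale_left_diff_distrib algebra_simps)
    then have s: "scale (c - d) a \<in> span B"
      using x y by (simp add: span_diff)
    have "c = d"
    proof (rule ccontr)
      assume "c \<noteq> d"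
      then have "a = scale (inverse (c - d)) (scale (c - d) a)" by simp
      then have "a \<in> span B" using s span_scale by metis
      then show False using a by simp
    qed
    then show "c = d \<and> x = y" using e by simp
  qed
  show ?case
    using insert.IH[OF ind] insert.hyps inj
    by (simp add: img card_image card_cartesian_product)
qed

definition indep_lists :: "'b set \<Rightarrow> nat \<Rightarrow> 'b list set" where
  "indep_lists W n = {xs. length xs = n \<and> distinct xs \<and> independent (set xs) \<and> set xs \<subseteq> W}"

lemma finite_indep_lists: "finite (indep_lists W n)"
  by (rule finite_subset[OF _ finite_lists_length_eq[of W n]]) (auto simp: indep_lists_def)

lemma card_indep_lists:
  assumes W: "subspace W"
    and cW: "card W = CARD('a) ^ a"
  shows "card (indep_lists W n) = (\<Prod>i<n. CARD('a) ^ a - CARD('a) ^ i)"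
proof (induction n)
  case 0
  have "indep_lists W 0 = {[]}" by (auto simp: indep_lists_def independent_empty)
  then show ?case by simp
next
  case (Suc n)
  have eq: "indep_lists W (Suc n) =
      (\<lambda>(xs, x). x # xs) ` (SIGMA xs : indep_lists W n. W - span (set xs))"
  proof
    show "indep_lists W (Suc n) \<subseteq> (\<lambda>(xs, x). x # xs) ` (SIGMA xs : indep_lists W n. W - span (set xs))"
    proof
      fix ys assume ys: "ys \<in> indep_lists W (Suc n)"
      then obtain x xs where c: "ys = x # xs" by (cases ys) (auto simp: indep_lists_def)
      have "x \<notin> set xs" "independent (insert x (set xs))"
        using ys c by (auto simp: indep_lists_def)
      then have "independent (set xs)" "x \<notin> span (set xs)"
        using independent_insert by auto
      then show "ys \<in> (\<lambda>(xs, x). x # xs) ` (SIGMA xs : indep_lists W n. W - span (set xs))"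
        using ys c by (intro image_eqI[where x = "(xs, x)"]) (auto simp: indep_lists_def)
    qed
    show "(\<lambda>(xs, x). x # xs) ` (SIGMA xs : indep_lists W n. W - span (set xs)) \<subseteq> indep_lists W (Suc n)"
      by (auto simp: indep_lists_def span_base dest: independent_insertI)
  qed
  have inj: "inj_on (\<lambda>(xs, x). x # xs) (SIGMA xs : indep_lists W n. W - span (set xs))"
    by (auto simp: inj_on_def)
  have each: "card (W - span (set xs)) = CARD('a) ^ a - CARD('a) ^ n"
    if "xs \<in> indep_lists W n" for xs
  proof -
    have "span (set xs) \<subseteq> W" using that W span_minimal by (auto simp: indep_lists_def)
    moreover have "card (span (set xs)) = CARD('a) ^ n"
      using card_span_independent[of "set xs"] that
      by (auto simp: indep_lists_def distinct_card)
    ultimately show ?thesis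
      using W cW by (simp add: card_Diff_subset finite_subset)
  qed
  show ?case
    unfolding eq using Suc W
    by (simp add: card_image[OF inj] finite_indep_lists each)
qed

lemma card_subspaces:
  assumes a: "dim (UNIV :: 'b set) = a"
  shows "real (card (i_subspaces b)) = gauss_binomial (CARD('a)) a b"
proof -
  let ?Q = "CARD('a)"
  have Q: "?Q > 1"
  proof -
    have "card {0, 1 :: 'a} \<le> ?Q" by (intro card_mono) auto
    then show ?thesis by simp
  qed
  have cards: "card S = ?Q ^ dim S" if "subspace S" for S
  proof -
    obtain B where B: "B \<subseteq> S" "independent B" "S \<subseteq> span B" "card B = dim S"
      using basis_exists by blast
    then have "span B = S" using that span_minimal by blast
    then show ?thesis
      using card_span_independent[of B] B finite[of B]
      by auto
  qed
  have cU: "card (UNIV :: 'b set) = ?Q ^ a"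
    using cards[OF subspace_UNIV] a by simp
  have finI: "finite (i_subspaces b)"
    by simp
  have un: "indep_lists UNIV b = (\<Union>S\<in>i_subspaces b. indep_lists S b)"
  proof
    show "indep_lists UNIV b \<subseteq> (\<Union>S\<in>i_subspaces b. indep_lists S b)"
    proof
      fix xs assume "xs \<in> indep_lists UNIV b"
      then have xs: "length xs = b" "distinct xs" "independent (set xs)"
        by (auto simp: indep_lists_def)
      have "span (set xs) \<in> i_subspaces b"
        using xs by (auto simp: i_subspaces_def dim_eq_card_independent distinct_card)
      moreover have "xs \<in> indep_lists (span (set xs)) b"
        using xs by (auto simp: indep_lists_def span_base)
      ultimately show "xs \<in> (\<Union>S\<in>i_subspaces b. indep_lists S b)" by blast
    qed
  qed (auto simp: indep_lists_def)
  have spn: "span (set xs) = S" if "S \<in> i_subspaces b" "xs \<in> indep_lists S b" for S xs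
  proof -
    have sub: "span (set xs) \<subseteq> S"
      using that span_minimal by (auto simp: indep_lists_def i_subspaces_def)
    have "card (span (set xs)) = card S"
      using card_span_independent[of "set xs"] cards[of S] that
      by (auto simp: indep_lists_def i_subspaces_def distinct_card)
    then show ?thesis
      using sub card_subset_eq[OF finite] by blast
  qed
  have each: "card (indep_lists S b) = (\<Prod>i<b. ?Q ^ b - ?Q ^ i)"
    if "S \<in> i_subspaces b" for S
    using card_indep_lists[of S b b] cards[of S] that
    by (auto simp: i_subspaces_def)
  have "card (indep_lists UNIV b) = (\<Sum>S\<in>i_subspaces b. card (indep_lists S b))"
    unfolding un using finI finite_indep_lists spn by (intro card_UN_disjoint) blast+
  also have "\<dots> = card (i_subspaces b) * (\<Prod>i<b. ?Q ^ b - ?Q ^ i)"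
    using each by simp
  finally have main: "(\<Prod>i<b. ?Q ^ a - ?Q ^ i) = card (i_subspaces b) * (\<Prod>i<b. ?Q ^ b - ?Q ^ i)"
    using card_indep_lists[OF subspace_UNIV cU, of b] by simp
  have pos: "(\<Prod>i<b. ?Q ^ b - ?Q ^ i) > 0"
    using Q by (intro prod_pos) (auto intro: power_strict_increasing)
  have den: "real (\<Prod>i<b. ?Q ^ b - ?Q ^ i) = (\<Prod>i<b. real ?Q ^ i) * (\<Prod>i<b. real ?Q ^ (i + 1) - 1)"
  proof -
    have "real (\<Prod>i<b. ?Q ^ b - ?Q ^ i) = (\<Prod>i<b. real ?Q ^ i * (real ?Q ^ (b - i) - 1))"
      unfolding of_nat_prod
    proof (rule prod.cong[OF refl])
      fix i assume i: "i \<in> {..<b}"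
      then have "?Q ^ i \<le> ?Q ^ b" using Q by (intro power_increasing) auto
      moreover have "real ?Q ^ b = real ?Q ^ i * real ?Q ^ (b - i)"
        using i by (simp flip: power_add)
      ultimately show "real (?Q ^ b - ?Q ^ i) = real ?Q ^ i * (real ?Q ^ (b - i) - 1)"
        by (simp add: of_nat_diff algebra_simps)
    qed
    also have "\<dots> = (\<Prod>i<b. real ?Q ^ i) * (\<Prod>i<b. real ?Q ^ (b - i) - 1)"
      by (rule prod.distrib)
    also have "(\<Prod>i<b. real ?Q ^ (b - i) - 1) = (\<Prod>i<b. real ?Q ^ (i + 1) - 1)"
      by (rule prod.reindex_bij_witness[where i = "\<lambda>i. b - Suc i" and j = "\<lambda>i. b - Suc i"]) 
         (auto simp: Suc_diff_Suc)
    finally show ?thesis .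
  qed
  have num: "real (\<Prod>i<b. ?Q ^ a - ?Q ^ i) = (\<Prod>i<b. real ?Q ^ i) * (\<Prod>i<b. real ?Q ^ (a - i) - 1)"
  proof (cases "a < b")
    case True
    then have 1: "(\<Prod>i<b. ?Q ^ a - ?Q ^ i) = 0" and 2: "(\<Prod>i<b. real ?Q ^ (a - i) - 1) = 0"
      by (intro prod_zero bexI[of _ a]; simp)+
    show ?thesis by (simp only: 1 2)
  next
    case False
    have "real (\<Prod>i<b. ?Q ^ a - ?Q ^ i) = (\<Prod>i<b. real ?Q ^ i * (real ?Q ^ (a - i) - 1))"
      unfolding of_nat_prod
    proof (rule prod.cong[OF refl])
      fix i assume i: "i \<in> {..<b}"
      then have "?Q ^ i \<le> ?Q ^ a" using Q False by (intro power_increasing) auto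
      moreover have "real ?Q ^ a = real ?Q ^ i * real ?Q ^ (a - i)"
        using i False by (simp flip: power_add)
      ultimately show "real (?Q ^ a - ?Q ^ i) = real ?Q ^ i * (real ?Q ^ (a - i) - 1)"
        by (simp add: of_nat_diff algebra_simps)
    qed
    then show ?thesis by (simp add: prod.distrib)
  qed
  have "real (card (i_subspaces b)) = real (\<Prod>i<b. ?Q ^ a - ?Q ^ i) / real (\<Prod>i<b. ?Q ^ b - ?Q ^ i)"
    unfolding main of_nat_mult
    by (rule nonzero_mult_div_cancel_right[symmetric]) (use pos in linarith)
  also have "\<dots> = (\<Prod>i<b. real ?Q ^ (a - i) - 1) / (\<Prod>i<b. real ?Q ^ (i + 1) - 1)"
    unfolding num den using Q by simp
  finally show ?thesis
    by (simp add: gauss_binomial_def prod_dividef)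
qed

end

end

theory Submission
  imports Defs "HOL-Computational_Algebra.Polynomial"
begin

text \<open>Let \<open>x\<close> be a \<open>GF(q)\<close>-basis of a \<open>k\<close>-subspace \<open>B\<close> of \<open>F\<^sup>m\<close>, where \<open>F = GF(q\<^sup>l)\<close>. If the \<open>F\<close>-linear
  relations of \<open>x\<close> are the multiples of one vector \<open>a\<close> in \<open>F\<^sup>k\<close>, then a change of basis preserves the
  \<open>GF(q)\<close>-span of the entries of \<open>a\<close>, so \<open>B\<close> determines an orbit of \<open>F\<^sup>*\<close> on the \<open>GF(q)\<close>-subspaces
  of \<open>F\<close>. The blocks are the \<open>B\<close> whose orbit belongs to a chosen family \<open>C\<close> of orbits of dimension
  at least 3, which makes them meet every group in dimension at most 1, and, if \<open>w = 1\<close>, also the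
  \<open>B\<close> without relations. Two \<open>F\<close>-independent vectors are extended to a block by choosing \<open>a\<close>, then all
  but one of the remaining basis vectors \<open>F\<close>-independently; the last one is forced. As each spanning
  \<open>k\<close>-tuple of a space in \<open>C\<close> is an admissible \<open>a\<close>, this counts the blocks through a 2-subspace, and
  the count does not depend on the 2-subspace. Moebius inversion over the lattice of subfields
  shows that enough orbits are available.\<close>

subsection \<open>Families over a subfield\<close>

text \<open>Why dimension 3: if two vectors of a block, independent over GF(q), were dependent over
  F, they could be completed to a basis, and a generator of its relations would have at most two
  nonzero entries, hence span a space of dimension at most 2. The formula for lambda comes from
  counting pairs of an extended basis and a relation vector \<open>a\<close>. A space of dimension
  r+1 is spanned by prod_{i<=r} (q^k - q^i) vectors \<open>a\<close>; an orbit with stabilizer of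
  order q^u holds (q^l-1)/(q^u-1) spaces; each basis with a relation has q^l-1 generators, so q^u-1
  is left in the denominator. The factors q^(ml)-q^(jl) count the free vectors, and division by the
  number of completions of the given pair inside one block cancels the factors with j from 2 to r.
  As for the orbits, the Gaussian binomial for t counts the spaces over GF(q^t), that is, those
  whose stabilizer contains GF(q^t); inversion isolates the exact stabilizer.\<close>

lemma inj_on_extend:
  assumes "j \<notin> I"
  shows "inj_on (\<lambda>(x, v). x(j := v)) (extensional I \<times> UNIV)"
proof (rule inj_onI, clarify)
  fix x v y w
  assume "x \<in> extensional I" "y \<in> extensional I" and e: "x(j := v) = y(j := w)"
  \<comment> \<open>Both families take the value \<open>undefined\<close> at \<open>j\<close>, which
    lies outside their index set, so the update loses no information.\<close>
  then have "x j = y j" using assms by (auto simp: extensional_def)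
  then show "x = y \<and> v = w"
    using e by (metis fun_upd_idem_iff fun_upd_same fun_upd_upd)
qed

text \<open>The number of ordered independent r-tuples in an n-dimensional space over the field with
  q elements, a q-analog of the falling factorial. Real values avoid truncated subtraction; the
  factor i = n makes it vanish for r > n.\<close>

definition qfall :: "nat \<Rightarrow> nat \<Rightarrow> nat \<Rightarrow> real" where
  "qfall q n r = (\<Prod>i<r. real q ^ n - real q ^ i)"

lemma qfall_0 [simp]: "qfall q n 0 = 1"
  by (simp add: qfall_def)

lemma qfall_Suc [simp]: "qfall q n (Suc r) = qfall q n r * (real q ^ n - real q ^ r)"
  by (simp add: qfall_def)

text \<open>The factor of index i + 1 is q times q^n - q^i, so shifting both arguments splits off
  the factor of index 0 and the power q^r. The induction in the rank count rests on this.\<close>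

lemma qfall_Suc_Suc: "qfall q (Suc n) (Suc r) = (real q ^ Suc n - 1) * real q ^ r * qfall q n r"
proof (induction r)
  case (Suc r)
  have "qfall q (Suc n) (Suc (Suc r)) =
      qfall q (Suc n) (Suc r) * (real q ^ Suc n - real q ^ Suc r)"
    by (rule qfall_Suc)
  also have "\<dots> = (real q ^ Suc n - 1) * real q ^ r * qfall q n r * (real q ^ Suc n - real q ^ Suc r)"
    by (simp only: Suc)
  also have "\<dots> = (real q ^ Suc n - 1) * real q ^ Suc r * qfall q n (Suc r)"
    by (simp add: algebra_simps)
  finally show ?case .
qed simp

lemma qfall_diag_nonzero: "q > 1 \<Longrightarrow> r \<le> n \<Longrightarrow> qfall q n r \<noteq> 0"
  by (auto simp: qfall_def)

text \<open>If the range passes i = n - c, both products contain a zero factor, which hides the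
  truncation of later natural differences. Otherwise all differences are exact.\<close>

lemma of_nat_prod_power_diff:
  assumes "q > 1" "c \<le> n"
  shows "real (\<Prod>i<r. q ^ n - q ^ (c + i)) = (\<Prod>i<r. real q ^ n - real q ^ (c + i))"
proof (cases "r \<le> n - c")
  case True
  have "real (q ^ n - q ^ (c + i)) = real q ^ n - real q ^ (c + i)" if "i < r" for i
    using assms True that power_increasing[of "c + i" n q] by (simp add: of_nat_diff)
  then show ?thesis by simp
next
  case False
  then have mem: "n - c \<in> {..<r}" by simp
  have "q ^ n - q ^ (c + (n - c)) = 0" "real q ^ n - real q ^ (c + (n - c)) = 0"
    using assms by auto
  then have "(\<Prod>i<r. q ^ n - q ^ (c + i)) = 0" "(\<Prod>i<r. real q ^ n - real q ^ (c + i)) = 0"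
    using mem by (meson finite_lessThan prod_zero)+
  then show ?thesis by (simp only: of_nat_0)
qed

lemma of_nat_qfall: "q > 1 \<Longrightarrow> real (\<Prod>i<r. q ^ n - q ^ i) = qfall q n r"
  using of_nat_prod_power_diff[of q 0 n r] by (simp add: qfall_def)

text \<open>\<open>E\<close> is a subset of the field type because the subfields that occur (the
  image of an embedding, stabilizers, fixed fields) arise inside the proof and act side by side on
  the same vectors.\<close>

locale subfield_space = vector_space scale
  for scale :: "'f::{field,finite} \<Rightarrow> 'v::{ab_group_add,finite} \<Rightarrow> 'v" +
  fixes E :: "'f set"
  assumes one_mem: "1 \<in> E"
    and diff_mem: "\<And>c d. c \<in> E \<Longrightarrow> d \<in> E \<Longrightarrow> c - d \<in> E"
    and mult_mem: "\<And>c d. c \<in> E \<Longrightarrow> d \<in> E \<Longrightarrow> c * d \<in> E"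
    and inverse_mem: "\<And>c. c \<in> E \<Longrightarrow> inverse c \<in> E"
begin

lemma zero_mem: "0 \<in> E"
  using diff_mem[OF one_mem one_mem] by simp

lemma uminus_mem: "c \<in> E \<Longrightarrow> - c \<in> E"
  using diff_mem[OF zero_mem] by simp

lemma add_mem: "c \<in> E \<Longrightarrow> d \<in> E \<Longrightarrow> c + d \<in> E"
  using diff_mem[OF _ uminus_mem] by simp

lemma sum_mem: "(\<And>i. i \<in> I \<Longrightarrow> f i \<in> E) \<Longrightarrow> sum f I \<in> E"
  by (induction I rule: infinite_finite_induct) (auto intro: zero_mem add_mem)

lemma card_field_gt_1: "card E > 1"
proof -
  have "card {0, 1 :: 'f} \<le> card E"
    by (intro card_mono) (auto intro: zero_mem one_mem)
  then show ?thesis by simp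
qed

text \<open>Coefficients range over the whole field here; only \<open>span_of\<close> and
  \<open>indep\<close> confine them to \<open>E\<close>. The same sum therefore expresses relations
  over either field. Families instead of sets let coefficient vectors be compared index by
  index.\<close>

definition comb :: "'i set \<Rightarrow> ('i \<Rightarrow> 'f) \<Rightarrow> ('i \<Rightarrow> 'v) \<Rightarrow> 'v" where
  "comb I a x = (\<Sum>i\<in>I. scale (a i) (x i))"

definition span_of :: "'i set \<Rightarrow> ('i \<Rightarrow> 'v) \<Rightarrow> 'v set" where
  "span_of I x = {comb I a x | a. a \<in> I \<rightarrow> E}"

definition indep :: "'i set \<Rightarrow> ('i \<Rightarrow> 'v) \<Rightarrow> bool" where
  "indep I x \<longleftrightarrow> (\<forall>a\<in>I \<rightarrow> E. comb I a x = 0 \<longrightarrow> (\<forall>i\<in>I. a i = 0))"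

definition E_subspace :: "'v set \<Rightarrow> bool" where
  "E_subspace S \<longleftrightarrow>
     0 \<in> S \<and> (\<forall>x\<in>S. \<forall>y\<in>S. x + y \<in> S) \<and> (\<forall>c\<in>E. \<forall>x\<in>S. scale c x \<in> S)"

lemma comb_cong:
  "(\<And>i. i \<in> I \<Longrightarrow> a i = b i) \<Longrightarrow> (\<And>i. i \<in> I \<Longrightarrow> x i = y i) \<Longrightarrow> comb I a x = comb I b y"
  by (simp add: comb_def)

lemma span_of_cong: "(\<And>i. i \<in> I \<Longrightarrow> x i = y i) \<Longrightarrow> span_of I x = span_of I y"
  using comb_cong[of I _ _ x y] unfolding span_of_def by metis

lemma indep_cong: "(\<And>i. i \<in> I \<Longrightarrow> x i = y i) \<Longrightarrow> indep I x = indep I y"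
  using comb_cong[of I _ _ x y] unfolding indep_def by metis

lemma comb_upd [simp]: "j \<notin> I \<Longrightarrow> comb I (a(j := c)) x = comb I a x"
  by (rule comb_cong) auto

lemma span_of_upd [simp]: "j \<notin> I \<Longrightarrow> span_of I (x(j := v)) = span_of I x"
  by (rule span_of_cong) auto

lemma indep_upd [simp]: "j \<notin> I \<Longrightarrow> indep I (x(j := v)) = indep I x"
  by (rule indep_cong) auto

lemma comb_add: "comb I (\<lambda>i. a i + b i) x = comb I a x + comb I b x"
  by (simp add: comb_def scale_left_distrib sum.distrib)

lemma comb_diff: "comb I (\<lambda>i. a i - b i) x = comb I a x - comb I b x"
  by (simp add: comb_def scale_left_diff_distrib sum_subtractf)

lemma comb_scale: "comb I (\<lambda>i. c * a i) x = scale c (comb I a x)"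
  by (simp add: comb_def scale_sum_right)

lemma comb_zero [simp]: "comb I (\<lambda>i. 0) x = 0"
  by (simp add: comb_def)

lemma comb_insert:
  "finite I \<Longrightarrow> j \<notin> I \<Longrightarrow> comb (insert j I) a x = scale (a j) (x j) + comb I a x"
  by (simp add: comb_def)

lemma comb_single: "finite I \<Longrightarrow> j \<in> I \<Longrightarrow> comb I (\<lambda>i. if i = j then 1 else 0) x = x j"
  by (simp add: comb_def if_distrib[of "\<lambda>c. scale c _"] cong: if_cong)

lemma E_subspace_scale: "E_subspace S \<Longrightarrow> c \<in> E \<Longrightarrow> x \<in> S \<Longrightarrow> scale c x \<in> S"
  by (simp add: E_subspace_def)

lemma E_subspace_diff:
  assumes "E_subspace S" "x \<in> S" "y \<in> S"
  shows "x - y \<in> S"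
proof -
  have "scale (- 1) y \<in> S"
    using assms uminus_mem[OF one_mem] unfolding E_subspace_def by blast
  then have "x + scale (- 1) y \<in> S"
    using assms unfolding E_subspace_def by blast
  then show ?thesis by simp
qed

lemma E_subspace_comb:
  assumes "E_subspace S" "a \<in> I \<rightarrow> E" "x \<in> I \<rightarrow> S"
  shows "comb I a x \<in> S"
  using assms(2,3) unfolding comb_def
  by (induction I rule: infinite_finite_induct) (use assms(1) in \<open>auto simp: E_subspace_def\<close>)

lemma E_subspace_span_of: "E_subspace (span_of I x)"
  unfolding E_subspace_def
proof (intro conjI ballI)
  show "0 \<in> span_of I x"
    unfolding span_of_def using comb_zero[of I x] zero_mem by force
next
  fix y z assume "y \<in> span_of I x" "z \<in> span_of I x"
  then obtain a b where "a \<in> I \<rightarrow> E" "b \<in> I \<rightarrow> E" "y = comb I a x" "z = comb I b x"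
    by (auto simp: span_of_def)
  then show "y + z \<in> span_of I x"
    using comb_add[of I a b x] unfolding span_of_def
    by (intro CollectI exI[of _ "\<lambda>i. a i + b i"]) (auto simp: Pi_iff intro: add_mem)
next
  fix c y assume "c \<in> E" "y \<in> span_of I x"
  then obtain a where "a \<in> I \<rightarrow> E" "y = comb I a x"
    by (auto simp: span_of_def)
  with \<open>c \<in> E\<close> show "scale c y \<in> span_of I x"
    using comb_scale[of I c a x] unfolding span_of_def
    by (intro CollectI exI[of _ "\<lambda>i. c * a i"]) (auto simp: Pi_iff intro: mult_mem)
qed

lemma span_of_minimal: "E_subspace S \<Longrightarrow> x \<in> I \<rightarrow> S \<Longrightarrow> span_of I x \<subseteq> S"
  by (auto simp: span_of_def intro: E_subspace_comb)

lemma span_of_base: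
  assumes "finite I" "j \<in> I"
  shows "x j \<in> span_of I x"
  unfolding span_of_def
  by (rule CollectI, rule exI[of _ "\<lambda>i. if i = j then 1 else 0"])
     (use assms comb_single[of I j x] one_mem zero_mem in auto)

lemma span_of_mono:
  assumes "finite J" "I \<subseteq> J"
  shows "span_of I x \<subseteq> span_of J x"
  using assms by (intro span_of_minimal[OF E_subspace_span_of]) (auto intro: span_of_base)

lemma span_of_subspace_eq:
  assumes "E_subspace S" "x \<in> I \<rightarrow> S" "card (span_of I x) = card S"
  shows "span_of I x = S"
  using span_of_minimal[OF assms(1,2)] assms(3) by (intro card_subset_eq) auto

lemma span_of_empty [simp]: "span_of {} x = {0}"
  by (auto simp: span_of_def comb_def)

lemma indep_empty [simp]: "indep {} x"
  by (simp add: indep_def)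

lemma span_of_insert_eq:
  assumes "finite I" "j \<notin> I"
  shows "span_of (insert j I) x = (\<lambda>(c, y). scale c (x j) + y) ` (E \<times> span_of I x)"
proof
  show "span_of (insert j I) x \<subseteq> (\<lambda>(c, y). scale c (x j) + y) ` (E \<times> span_of I x)"
    using assms by (auto simp: span_of_def comb_insert Pi_iff image_iff)
  show "(\<lambda>(c, y). scale c (x j) + y) ` (E \<times> span_of I x) \<subseteq> span_of (insert j I) x"
  proof clarify
    fix c y assume c: "c \<in> E" and "y \<in> span_of I x"
    then obtain a where a: "a \<in> I \<rightarrow> E" "y = comb I a x"
      by (auto simp: span_of_def)
    have "comb (insert j I) (a(j := c)) x = scale c (x j) + y"
      using assms a by (auto simp: comb_insert)
    then show "scale c (x j) + y \<in> span_of (insert j I) x"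
      unfolding span_of_def using a c
      by (intro CollectI exI[of _ "a(j := c)"]) auto
  qed
qed

lemma scale_eq_imp_mem:
  assumes S: "E_subspace S" and c: "c \<in> E" "c \<noteq> 0" and v: "scale c v \<in> S"
  shows "v \<in> S"
proof -
  have "v = scale (inverse c) (scale c v)" using c by simp
  then show ?thesis using E_subspace_scale[OF S inverse_mem[OF c(1)] v] by simp
qed

text \<open>A nonzero coefficient of the new vector can be inverted inside \<open>E\<close>. All
  counts of bases recurse along this criterion.\<close>

lemma indep_insert:
  assumes "finite I" "j \<notin> I"
  shows "indep (insert j I) x \<longleftrightarrow> indep I x \<and> x j \<notin> span_of I x"
proof
  assume L: "indep (insert j I) x"
  show "indep I x \<and> x j \<notin> span_of I x"
  proof
    show "indep I x"
      unfolding indep_def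
    proof (intro ballI impI)
      fix a i assume a: "a \<in> I \<rightarrow> E" and z: "comb I a x = 0" and i: "i \<in> I"
      have "comb (insert j I) (a(j := 0)) x = 0"
        using assms z by (auto simp: comb_insert)
      moreover have "a(j := 0) \<in> insert j I \<rightarrow> E" using a zero_mem by auto
      ultimately have "(a(j := 0)) i = 0" using L i unfolding indep_def by blast
      then show "a i = 0" using i assms by (auto split: if_splits)
    qed
    show "x j \<notin> span_of I x"
    proof
      assume "x j \<in> span_of I x"
      then obtain a where a: "a \<in> I \<rightarrow> E" "x j = comb I a x" by (auto simp: span_of_def)
      have "comb (insert j I) (a(j := - 1)) x = 0"
        using assms a by (auto simp: comb_insert)
      moreover have "a(j := - 1) \<in> insert j I \<rightarrow> E" using a uminus_mem[OF one_mem] by auto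
      ultimately have "(a(j := - 1)) j = 0" using L unfolding indep_def by blast
      then show False by simp
    qed
  qed
next
  assume R: "indep I x \<and> x j \<notin> span_of I x"
  show "indep (insert j I) x"
    unfolding indep_def
  proof (intro ballI impI)
    fix a i assume a: "a \<in> insert j I \<rightarrow> E" and z: "comb (insert j I) a x = 0"
      and i: "i \<in> insert j I"
    have e: "scale (a j) (x j) + comb I a x = 0" using z assms by (simp add: comb_insert)
    have mem: "comb I a x \<in> span_of I x" using a by (auto simp: span_of_def)
    have "scale (a j) (x j) = 0 - comb I a x" using e by (simp add: eq_neg_iff_add_eq_0)
    also have "\<dots> \<in> span_of I x"
      using mem E_subspace_span_of by (intro E_subspace_diff) (auto simp: E_subspace_def)
    finally have "a j = 0"
      using R a scale_eq_imp_mem[OF E_subspace_span_of, of "a j" "x j" I x] by auto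
    moreover have "\<forall>i\<in>I. a i = 0"
      using R e a \<open>a j = 0\<close> by (auto simp: indep_def Pi_iff)
    ultimately show "a i = 0" using i by auto
  qed
qed

lemma card_span_of_insert:
  assumes "finite I" "j \<notin> I" "x j \<notin> span_of I x"
  shows "card (span_of (insert j I) x) = card E * card (span_of I x)"
proof -
  have "inj_on (\<lambda>(c, y). scale c (x j) + y) (E \<times> span_of I x)"
  proof (rule inj_onI, clarsimp)
    fix c y d z
    assume mem: "c \<in> E" "y \<in> span_of I x" "d \<in> E" "z \<in> span_of I x"
      and e: "scale c (x j) + y = scale d (x j) + z"
    have "scale (c - d) (x j) = z - y"
      using e by (simp add: scale_left_diff_distrib algebra_simps)
    then have s: "scale (c - d) (x j) \<in> span_of I x"
      using mem E_subspace_diff[OF E_subspace_span_of] by simp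
    have "c - d = 0"
      using s scale_eq_imp_mem[OF E_subspace_span_of diff_mem[OF mem(1,3)] _ s] assms(3) by blast
    then show "c = d \<and> y = z" using e by simp
  qed
  then show ?thesis
    using assms by (simp add: span_of_insert_eq card_image card_cartesian_product)
qed

lemma span_of_insert_absorb:
  assumes "finite I" "x j \<in> span_of I x"
  shows "span_of (insert j I) x = span_of I x"
proof
  show "span_of (insert j I) x \<subseteq> span_of I x"
    using assms by (intro span_of_minimal[OF E_subspace_span_of]) (auto intro: span_of_base)
qed (use assms in \<open>auto intro: span_of_mono[THEN subsetD]\<close>)

lemma card_span_of:
  assumes "finite I" "indep I x"
  shows "card (span_of I x) = card E ^ card I"
  using assms
proof (induction I rule: finite_induct)
  case (insert j I)
  then show ?case
    by (simp add: indep_insert card_span_of_insert)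
qed simp

lemma card_span_of_power: "finite I \<Longrightarrow> \<exists>n. card (span_of I x) = card E ^ n"
proof (induction I rule: finite_induct)
  case empty
  then show ?case by (auto intro: exI[of _ 0])
next
  case (insert j I)
  then obtain n where n: "card (span_of I x) = card E ^ n" by blast
  show ?case
  proof (cases "x j \<in> span_of I x")
    case True
    then show ?thesis using insert n span_of_insert_absorb by metis
  next
    case False
    then have "card (span_of (insert j I) x) = card E ^ Suc n"
      using insert.hyps n by (simp add: card_span_of_insert)
    then show ?thesis by blast
  qed
qed

lemma card_E_subspace:
  assumes S: "E_subspace S"
  shows "\<exists>n. card S = card E ^ n"
proof -
  \<comment> \<open>The space is spanned by the family of all its elements, so no basis has to be
    chosen.\<close>
  have "span_of S (\<lambda>v. v) = S"
    using span_of_minimal[OF S, of "\<lambda>v. v" S] span_of_base[of S _ "\<lambda>v. v"] by auto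
  then show ?thesis using card_span_of_power[of S "\<lambda>v. v"] by auto
qed

text \<open>The missing vectors are chosen one after the other, each outside the span of the earlier
  ones; when i of them are placed, that span has \<open>card E ^ (card I + i)\<close>
  elements.\<close>

lemma card_indep_extensions:
  assumes S: "E_subspace S" and I: "finite I" "x0 \<in> I \<rightarrow> S" "indep I x0"
    and J: "finite J" "I \<inter> J = {}"
  shows "card {x \<in> (I \<union> J) \<rightarrow>\<^sub>E S. (\<forall>i\<in>I. x i = x0 i) \<and> indep (I \<union> J) x} =
    (\<Prod>i<card J. card S - card E ^ (card I + i))"
  using J
proof (induction J rule: finite_induct)
  case empty
  have "{x \<in> I \<rightarrow>\<^sub>E S. (\<forall>i\<in>I. x i = x0 i) \<and> indep I x} = {restrict x0 I}"
    (is "?L = _")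
  proof
    show "?L \<subseteq> {restrict x0 I}"
      by (auto simp: fun_eq_iff restrict_def PiE_iff extensional_def)
    show "{restrict x0 I} \<subseteq> ?L"
      using I indep_cong[of I "restrict x0 I" x0] by auto
  qed
  then show ?case by simp
next
  case (insert j J)
  let ?X = "\<lambda>J. {x \<in> (I \<union> J) \<rightarrow>\<^sub>E S. (\<forall>i\<in>I. x i = x0 i) \<and> indep (I \<union> J) x}"
  have j: "j \<notin> I \<union> J" and fin: "finite (I \<union> J)" and un: "I \<union> insert j J = insert j (I \<union> J)"
    using insert I by auto
  have eq: "?X (insert j J) = (\<lambda>(x, v). x(j := v)) ` (SIGMA x : ?X J. S - span_of (I \<union> J) x)"
  proof (intro equalityI subsetI)
    fix z assume z: "z \<in> ?X (insert j J)"
    let ?x = "restrict z (I \<union> J)"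
    have ind: "indep (I \<union> J) z" "z j \<notin> span_of (I \<union> J) z"
      using z j fin by (auto simp: un indep_insert)
    have "indep (I \<union> J) ?x" "span_of (I \<union> J) ?x = span_of (I \<union> J) z"
      using ind(1) indep_cong[of "I \<union> J" ?x z] span_of_cong[of "I \<union> J" ?x z] by auto
    moreover have "?x(j := z j) = z"
      using z by (auto simp: fun_eq_iff restrict_def PiE_iff extensional_def)
    ultimately show "z \<in> (\<lambda>(x, v). x(j := v)) ` (SIGMA x : ?X J. S - span_of (I \<union> J) x)"
      using z ind by (intro image_eqI[where x = "(?x, z j)"]) auto
  next
    fix z assume "z \<in> (\<lambda>(x, v). x(j := v)) ` (SIGMA x : ?X J. S - span_of (I \<union> J) x)"
    then obtain x v where x: "x \<in> ?X J" "v \<in> S" "v \<notin> span_of (I \<union> J) x" "z = x(j := v)"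
      by auto
    have "indep (I \<union> J) z" "span_of (I \<union> J) z = span_of (I \<union> J) x"
      using x j by auto
    then have "indep (insert j (I \<union> J)) z"
      using x j fin by (auto simp: indep_insert)
    moreover have "z \<in> insert j (I \<union> J) \<rightarrow>\<^sub>E S"
      using x by (auto simp: PiE_iff extensional_def)
    moreover have "\<forall>i\<in>I. z i = x0 i" using x j by auto
    ultimately show "z \<in> ?X (insert j J)" by (simp add: un)
  qed
  have inj: "inj_on (\<lambda>(x, v). x(j := v)) (SIGMA x : ?X J. S - span_of (I \<union> J) x)"
    by (rule inj_on_subset[OF inj_on_extend[OF j]]) (auto simp: PiE_iff)
  have each: "card (S - span_of (I \<union> J) x) = card S - card E ^ (card I + card J)"
    if "x \<in> ?X J" for x
  proof -
    have "card (span_of (I \<union> J) x) = card E ^ (card I + card J)"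
      using that fin insert I by (subst card_span_of) (auto simp: card_Un_disjoint)
    then show ?thesis
      using that S span_of_minimal[of S x "I \<union> J"]
      by (subst card_Diff_subset) auto
  qed
  have "finite (?X J)"
    by (rule finite_subset[OF _ finite_PiE[of "I \<union> J" "\<lambda>_. S"]]) (use fin in auto)
  then have "card (?X (insert j J)) = card (?X J) * (card S - card E ^ (card I + card J))"
    unfolding eq using each by (subst card_image[OF inj]) (simp add: card_SigmaI)
  then show ?case using insert by simp
qed

lemma card_indep_families:
  assumes "E_subspace S" "finite J"
  shows "card {x \<in> J \<rightarrow>\<^sub>E S. indep J x} = (\<Prod>i<card J. card S - card E ^ i)"
  using card_indep_extensions[of S "{}" undefined J] assms by simp

text \<open>Existence is read off from the count: for \<open>card I + card J \<le> n\<close> no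
  factor vanishes.\<close>

lemma ex_indep_extension:
  assumes S: "E_subspace S" "card S = card E ^ n" and I: "finite I" "x0 \<in> I \<rightarrow> S" "indep I x0"
    and J: "finite J" "I \<inter> J = {}" and n: "card I + card J \<le> n"
  shows "\<exists>x \<in> (I \<union> J) \<rightarrow>\<^sub>E S. (\<forall>i\<in>I. x i = x0 i) \<and> indep (I \<union> J) x"
proof -
  have "(\<Prod>i<card J. card S - card E ^ (card I + i)) > 0"
    using S(2) n card_field_gt_1 by (intro prod_pos) (auto intro: power_strict_increasing)
  then have "{x \<in> (I \<union> J) \<rightarrow>\<^sub>E S. (\<forall>i\<in>I. x i = x0 i) \<and> indep (I \<union> J) x} \<noteq> {}"
    unfolding card_indep_extensions[OF S(1) I J, symmetric] by force
  then show ?thesis by blast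
qed

text \<open>The independent b-tuples in S are sorted by the space they span, and each such space has
  equally many ordered bases. The product form avoids division of natural numbers.\<close>

lemma card_E_subspaces:
  assumes S: "E_subspace S"
  shows "card {T. E_subspace T \<and> T \<subseteq> S \<and> card T = card E ^ b} * (\<Prod>i<b. card E ^ b - card E ^ i) =
    (\<Prod>i<b. card S - card E ^ i)"
proof -
  let ?T = "{T. E_subspace T \<and> T \<subseteq> S \<and> card T = card E ^ b}"
  let ?X = "\<lambda>S. {x \<in> {..<b} \<rightarrow>\<^sub>E S. indep {..<b} x}"
  have spn: "span_of {..<b} x = T" if "T \<in> ?T" "x \<in> ?X T" for T x
    using that card_span_of[of "{..<b}" x] by (intro span_of_subspace_eq) auto
  have "?X S = (\<Union>T\<in>?T. ?X T)"
  proof (intro equalityI subsetI)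
    fix x assume x: "x \<in> ?X S"
    have "span_of {..<b} x \<in> ?T"
      using x S card_span_of[of "{..<b}" x] span_of_minimal[of S x "{..<b}"]
      by (auto simp: E_subspace_span_of)
    moreover have "x \<in> ?X (span_of {..<b} x)"
      using x by (auto intro: span_of_base simp: PiE_iff)
    ultimately show "x \<in> (\<Union>T\<in>?T. ?X T)" by blast
  qed (auto simp: PiE_iff)
  moreover have "card (\<Union>T\<in>?T. ?X T) = (\<Sum>T\<in>?T. card (?X T))"
  proof (rule card_UN_disjoint)
    show "\<forall>T\<in>?T. finite (?X T)"
    proof
      fix T
      show "finite (?X T)"
        by (rule finite_subset[OF _ finite_PiE[of "{..<b}" "\<lambda>_. T"]]) auto
    qed
    show "\<forall>T\<in>?T. \<forall>T'\<in>?T. T \<noteq> T' \<longrightarrow> ?X T \<inter> ?X T' = {}"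
    proof (intro ballI impI, rule ccontr)
      fix T T' assume T: "T \<in> ?T" "T' \<in> ?T" "T \<noteq> T'" "?X T \<inter> ?X T' \<noteq> {}"
      then obtain x where "x \<in> ?X T" "x \<in> ?X T'" by blast
      then show False using spn[OF T(1)] spn[OF T(2)] T(3) by metis
    qed
  qed simp
  moreover have "card (?X T) = (\<Prod>i<b. card E ^ b - card E ^ i)" if "T \<in> ?T" for T
    using that card_indep_families[of T "{..<b}"] by auto
  ultimately show ?thesis
    using card_indep_families[OF S, of "{..<b}"] by simp
qed

lemma finite_families [simp]: "finite I \<Longrightarrow> finite {x \<in> I \<rightarrow>\<^sub>E (S :: 'v set). P x}"
  by (rule finite_subset[OF _ finite_PiE[of I "\<lambda>_. S"]]) auto

text \<open>In coordinates, these families are the \<open>card I\<close> by D matrices of rank r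
  over \<open>E\<close>, and \<open>qfall (card E) r r\<close> is the order of GL(r). A new vector
  either lies in the span, with q^r choices, or raises the rank from r - 1, with q^D - q^(r-1)
  choices, where q is \<open>card E\<close>.\<close>

lemma card_families_of_rank:
  assumes U: "E_subspace U" "card U = card E ^ D" and "finite I"
  shows "real (card {x \<in> I \<rightarrow>\<^sub>E U. card (span_of I x) = card E ^ r}) * qfall (card E) r r =
    qfall (card E) (card I) r * qfall (card E) D r"
  using \<open>finite I\<close>
proof (induction I arbitrary: r rule: finite_induct)
  case empty
  have "qfall (card E) 0 r = (if r = 0 then 1 else 0)"
    by (cases r) (simp_all add: qfall_def prod.lessThan_Suc_shift del: prod.lessThan_Suc)
  moreover have "Suc 0 = card E ^ r \<longleftrightarrow> r = 0"
    using card_field_gt_1 by (metis One_nat_def less_numeral_extra(4) power_0 nat_power_eq_Suc_0_iff)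
  ultimately show ?case by simp
next
  case (insert j I)
  let ?q = "card E"
  let ?X = "\<lambda>I r. {x \<in> I \<rightarrow>\<^sub>E U. card (span_of I x) = ?q ^ r}"
  have inj: "inj_on (\<lambda>(x, v). x(j := v)) (Sigma (?X I r) V)" for r V
    by (rule inj_on_subset[OF inj_on_extend[OF insert.hyps(2)]]) (auto simp: PiE_iff)
  let ?stay = "\<lambda>r. (\<lambda>(x, v). x(j := v)) ` (SIGMA x : ?X I r. span_of I x)"
  let ?grow = "\<lambda>r. (\<lambda>(x, v). x(j := v)) ` (SIGMA x : ?X I r. U - span_of I x)"
  have sub: "span_of I x \<subseteq> U" if "x \<in> I \<rightarrow>\<^sub>E U" for x
    using that by (intro span_of_minimal[OF U(1)]) auto
  have split: "z \<in> (\<lambda>(x, v). x(j := v)) ` (SIGMA x : ?X I r. V x)"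
    if "z \<in> insert j I \<rightarrow>\<^sub>E U" "card (span_of I z) = ?q ^ r" "z j \<in> V (restrict z I)" for z r V
  proof -
    have "z = (restrict z I)(j := z j)"
      using that(1) by (auto simp: fun_eq_iff restrict_def PiE_iff extensional_def)
    moreover have "span_of I (restrict z I) = span_of I z"
      by (rule span_of_cong) auto
    ultimately show ?thesis
      using that by (intro image_eqI[where x = "(restrict z I, z j)"]) auto
  qed
  have stay: "card (?stay r) = card (?X I r) * ?q ^ r" for r
    using insert.hyps by (subst card_image[OF inj]) (simp add: card_SigmaI)
  have grow: "real (card (?grow r)) = real (card (?X I r)) * (real ?q ^ D - real ?q ^ r)" for r
  proof -
    have "real (card (U - span_of I x)) = real ?q ^ D - real ?q ^ r" if "x \<in> ?X I r" for x
      using sub[of x] that U(2) card_mono[OF _ sub[of x]]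
      by (simp add: card_Diff_subset of_nat_diff)
    then show ?thesis
      using insert.hyps by (subst card_image[OF inj]) (simp add: card_SigmaI)
  qed
  have stay_sub: "?stay r \<subseteq> ?X (insert j I) r" for r
  proof clarify
    fix x v assume x: "x \<in> I \<rightarrow>\<^sub>E U" "card (span_of I x) = ?q ^ r" and v: "v \<in> span_of I x"
    then have "v \<in> U" using sub by blast
    then show "x(j := v) \<in> insert j I \<rightarrow>\<^sub>E U \<and> card (span_of (insert j I) (x(j := v))) = ?q ^ r"
      using insert.hyps x v by (auto simp: span_of_insert_absorb PiE_iff extensional_def)
  qed
  show ?case
  proof (cases r)
    case 0
    \<comment> \<open>Rank 0 cannot arise by growth, since growth multiplies the size of the span by
      \<open>card E\<close> > 1.\<close>
    have "?X (insert j I) 0 \<subseteq> ?stay 0"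
    proof
      fix z assume z: "z \<in> ?X (insert j I) 0"
      have "z j \<in> span_of I z"
        using z insert.hyps card_span_of_insert[of I j z] card_field_gt_1 by auto
      moreover have "card (span_of I z) = 1"
        using z calculation insert.hyps by (simp add: span_of_insert_absorb)
      moreover have "span_of I (restrict z I) = span_of I z"
        by (rule span_of_cong) auto
      ultimately show "z \<in> ?stay 0"
        using z by (intro split) auto
    qed
    then have "?X (insert j I) 0 = ?stay 0" by (rule equalityI) (rule stay_sub)
    then show ?thesis
      using 0 insert.IH[of 0] stay[of 0] by simp
  next
    case (Suc s)
    have "?X (insert j I) r = ?stay r \<union> ?grow s"
    proof
      show "?X (insert j I) r \<subseteq> ?stay r \<union> ?grow s"
      proof
        fix z assume z: "z \<in> ?X (insert j I) r"
        have e: "span_of I (restrict z I) = span_of I z"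
          by (rule span_of_cong) auto
        show "z \<in> ?stay r \<union> ?grow s"
        proof (cases "z j \<in> span_of I z")
          case True
          then have "z \<in> ?stay r"
            using z insert.hyps e by (intro split) (auto simp: span_of_insert_absorb)
          then show ?thesis ..
        next
          case False
          then have "card (span_of I z) = ?q ^ s"
            using z insert.hyps card_field_gt_1 Suc by (auto simp: card_span_of_insert)
          then have "z \<in> ?grow s"
            using z False e by (intro split) auto
          then show ?thesis ..
        qed
      qed
      have "?grow s \<subseteq> ?X (insert j I) r"
        using insert.hyps Suc
        by (auto simp: card_span_of_insert PiE_iff extensional_def)
      with stay_sub show "?stay r \<union> ?grow s \<subseteq> ?X (insert j I) r"
        by (rule Un_least)
    qed
    moreover have "?stay r \<inter> ?grow s = {}"
    proof -
      have "z j \<in> span_of I z" if "z \<in> ?stay r" for z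
        using that insert.hyps by auto
      moreover have "z j \<notin> span_of I z" if "z \<in> ?grow s" for z
        using that insert.hyps by auto
      ultimately show ?thesis by (meson disjoint_iff)
    qed
    moreover have "finite (?stay r)" "finite (?grow s)"
      using insert.hyps by (auto intro!: finite_imageI finite_SigmaI)
    ultimately have "real (card (?X (insert j I) r)) = real (card (?stay r)) + real (card (?grow s))"
      by (simp add: card_Un_disjoint)
    also have "\<dots> = real (card (?X I r)) * real ?q ^ r +
        real (card (?X I s)) * (real ?q ^ D - real ?q ^ s)"
      using stay grow by simp
    finally have c: "real (card (?X (insert j I) r)) = \<dots>" .
    have 1: "real (card (?X I r)) * qfall ?q r r =
        qfall ?q (card I) s * (real ?q ^ card I - real ?q ^ s) * (qfall ?q D s * (real ?q ^ D - real ?q ^ s))"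
      using insert.IH[of r] Suc by simp
    have 2: "qfall ?q r r = (real ?q ^ r - 1) * real ?q ^ s * qfall ?q s s"
      using qfall_Suc_Suc[of ?q s s] Suc by simp
    have "real (card (?X (insert j I) r)) * qfall ?q r r =
        real (card (?X I r)) * qfall ?q r r * real ?q ^ r +
        (real (card (?X I s)) * qfall ?q s s) * (real ?q ^ D - real ?q ^ s) *
          ((real ?q ^ r - 1) * real ?q ^ s)"
    proof -
      have "(a * b + c * d) * f = a * f * b + (c * g) * d * e" if "f = e * g"
        for a b c d e f g :: real
        by (simp add: that algebra_simps)
      from this[OF 2] show ?thesis unfolding c .
    qed
    also have "\<dots> = qfall ?q (card I) s * (qfall ?q D s * (real ?q ^ D - real ?q ^ s)) *
        ((real ?q ^ card I - real ?q ^ s) * real ?q ^ r + (real ?q ^ r - 1) * real ?q ^ s)"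
      unfolding 1 insert.IH[of s] by (simp add: algebra_simps)
    \<comment> \<open>The two ways of reaching rank r = s + 1 recombine as in the q-Pascal
      rule.\<close>
    also have "(real ?q ^ card I - real ?q ^ s) * real ?q ^ r + (real ?q ^ r - 1) * real ?q ^ s =
        (real ?q ^ Suc (card I) - 1) * real ?q ^ s"
      using Suc by (simp add: algebra_simps)
    also have "qfall ?q (card I) s * (qfall ?q D s * (real ?q ^ D - real ?q ^ s)) *
        ((real ?q ^ Suc (card I) - 1) * real ?q ^ s) = qfall ?q (Suc (card I)) r * qfall ?q D r"
      using Suc qfall_Suc_Suc[of ?q "card I" s] by (simp del: qfall_Suc add: qfall_Suc[of _ D])
    finally show ?thesis using insert.hyps by simp
  qed
qed

text \<open>The case of full rank r = d: a family in U spans U once its span has the size of U, and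
  \<open>qfall (card E) d d\<close> cancels. For d > \<open>card I\<close> both sides are 0.\<close>

lemma card_spanning_families:
  assumes U: "E_subspace U" "card U = card E ^ d" and "finite I"
  shows "real (card {x \<in> I \<rightarrow>\<^sub>E UNIV. span_of I x = U}) = qfall (card E) (card I) d"
proof -
  have "{x \<in> I \<rightarrow>\<^sub>E UNIV. span_of I x = U} = {x \<in> I \<rightarrow>\<^sub>E U. card (span_of I x) = card E ^ d}"
    using assms span_of_base[OF \<open>finite I\<close>] span_of_subspace_eq[OF U(1), of _ I]
    by (auto simp: PiE_iff)
  then show ?thesis
    using card_families_of_rank[OF U \<open>finite I\<close>, of d] qfall_diag_nonzero[OF card_field_gt_1, of d d]
    by simp
qed

end

subsection \<open>Blocks with prescribed relations\<close>

context subfield_space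
begin

lemma E_subspace_UNIV: "E_subspace UNIV"
  by (simp add: E_subspace_def)

lemma card_span_of_le: "finite I \<Longrightarrow> card (span_of I x) \<le> card E ^ card I"
proof (induction I rule: finite_induct)
  case (insert j I)
  show ?case
  proof (cases "x j \<in> span_of I x")
    case True
    have "card E ^ card I \<le> card E ^ card (insert j I)"
      using insert.hyps card_field_gt_1 by (intro power_increasing) auto
    with insert.IH have "card (span_of I x) \<le> card E ^ card (insert j I)" by (rule order_trans)
    then show ?thesis using True insert.hyps by (simp only: span_of_insert_absorb)
  qed (use insert in \<open>simp add: card_span_of_insert\<close>)
qed simp

lemma span_of_drop_zeros:
  assumes "finite I" "J \<subseteq> I" "\<And>i. i \<in> I - J \<Longrightarrow> x i = 0"
  shows "span_of I x = span_of J x"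
proof
  have J: "finite J" using assms finite_subset by blast
  show "span_of I x \<subseteq> span_of J x"
  proof (rule span_of_minimal[OF E_subspace_span_of], rule Pi_I)
    fix i assume "i \<in> I"
    then show "x i \<in> span_of J x"
      using assms span_of_base[OF J, of i x] E_subspace_span_of[of J x]
      by (cases "i \<in> J") (auto simp: E_subspace_def)
  qed
  show "span_of J x \<subseteq> span_of I x"
    using assms by (intro span_of_mono) auto
qed

text \<open>A second basis \<open>y\<close> of the span of \<open>x\<close> acts on coordinate vectors by an invertible matrix over
  \<open>E\<close>, which transports all relations, also those with coefficients outside \<open>E\<close>.\<close>

definition transport :: "'i set \<Rightarrow> ('i \<Rightarrow> 'i \<Rightarrow> 'f) \<Rightarrow> ('i \<Rightarrow> 'f) \<Rightarrow> 'i \<Rightarrow> 'f" where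
  "transport I R a j = (\<Sum>i\<in>I. a i * R i j)"

lemma comb_transport:
  assumes "\<And>i. i \<in> I \<Longrightarrow> x i = comb I (R i) y"
  shows "comb I (transport I R a) y = comb I a x"
proof -
  have "comb I a x = (\<Sum>i\<in>I. scale (a i) (comb I (R i) y))"
    unfolding comb_def[of I a] using assms by simp
  also have "\<dots> = (\<Sum>i\<in>I. \<Sum>j\<in>I. scale (a i * R i j) (y j))"
    by (simp add: comb_def scale_sum_right)
  also have "\<dots> = (\<Sum>j\<in>I. \<Sum>i\<in>I. scale (a i * R i j) (y j))"
    by (rule sum.swap)
  also have "\<dots> = comb I (transport I R a) y"
    by (simp add: comb_def transport_def scale_sum_left)
  finally show ?thesis ..
qed

text \<open>The product of the two coordinate matrices has entries in \<open>E\<close>, so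
  independence of x over \<open>E\<close> already makes it the identity. As a matrix identity it
  then applies to arbitrary field coefficients \<open>a\<close>.\<close>

lemma transport_inverse:
  assumes fin: "finite I" and x: "indep I x"
    and R: "\<And>i. i \<in> I \<Longrightarrow> x i = comb I (R i) y" "\<And>i. i \<in> I \<Longrightarrow> R i \<in> I \<rightarrow> E"
    and P: "\<And>i. i \<in> I \<Longrightarrow> y i = comb I (P i) x" "\<And>i. i \<in> I \<Longrightarrow> P i \<in> I \<rightarrow> E"
    and i: "i \<in> I"
  shows "transport I P (transport I R a) i = a i"
proof -
  let ?d = "\<lambda>i i'. if i' = i then 1 else (0 :: 'f)"
  have delta: "transport I P (R j) i = ?d j i" if j: "j \<in> I" for j
  proof -
    let ?b = "\<lambda>i. transport I P (R j) i - ?d j i"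
    have "comb I ?b x = comb I (R j) y - comb I (?d j) x"
      using comb_transport[of I y P x, OF P(1)] by (simp add: comb_diff)
    also have "\<dots> = 0"
      using R(1)[OF j] comb_single[OF fin j, of x] by simp
    finally have "comb I ?b x = 0" .
    moreover have "transport I P (R j) i \<in> E" if "i \<in> I" for i
      unfolding transport_def using R(2)[OF j] P(2) that by (intro sum_mem mult_mem) auto
    then have "?b \<in> I \<rightarrow> E"
      using one_mem zero_mem by (auto intro!: diff_mem)
    ultimately have "?b i = 0" using x i unfolding indep_def by blast
    then show ?thesis by simp
  qed
  have "transport I P (transport I R a) i = (\<Sum>j\<in>I. a j * transport I P (R j) i)"
    unfolding transport_def sum_distrib_right sum_distrib_left
    by (subst sum.swap) (simp add: mult.assoc)
  also have "\<dots> = (\<Sum>j\<in>I. if j = i then a j else 0)"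
    by (intro sum.cong refl) (simp add: delta)
  also have "\<dots> = a i" using fin i by simp
  finally show ?thesis .
qed

lemma transport_cong: "(\<And>i. i \<in> I \<Longrightarrow> a i = b i) \<Longrightarrow> transport I R a = transport I R b"
  by (auto simp: transport_def fun_eq_iff)

lemma transport_scale: "transport I R (\<lambda>i. c * a i) j = c * transport I R a j"
  by (simp add: transport_def sum_distrib_left mult.assoc)

lemma ex_coordinates:
  assumes "x \<in> I \<rightarrow> span_of I y"
  shows "\<exists>R. \<forall>i\<in>I. x i = comb I (R i) y \<and> R i \<in> I \<rightarrow> E"
proof -
  have "\<forall>i\<in>I. \<exists>a. x i = comb I a y \<and> a \<in> I \<rightarrow> E"
    using assms by (auto simp: span_of_def)
  then show ?thesis by metis
qed

end

text \<open>The field acts on \<open>'v\<close>, while the scalars of a block are those in \<open>E\<close>. The sublocale \<open>full\<close>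
  is linear algebra over the whole field and \<open>coef\<close> treats the field as an \<open>E\<close>-space. The family
  \<open>C\<close> consists of the \<open>E\<close>-subspaces that coefficient vectors of relations may span.\<close>

locale relation_blocks = subfield_space scale E
  for scale :: "'f::{field,finite} \<Rightarrow> 'v::{ab_group_add,finite} \<Rightarrow> 'v" and E +
  fixes k :: nat and w :: bool and C :: "'f set set"
  assumes k_ge_3: "3 \<le> k"
    and C_E_subspace: "\<And>U. U \<in> C \<Longrightarrow> subfield_space.E_subspace (*) E U"
    and C_card: "\<And>U. U \<in> C \<Longrightarrow> card E ^ 3 \<le> card U"
    and C_scale: "\<And>U c. U \<in> C \<Longrightarrow> c \<noteq> 0 \<Longrightarrow> (*) c ` U \<in> C"

sublocale relation_blocks \<subseteq> full: subfield_space scale UNIV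
  by unfold_locales auto

sublocale relation_blocks \<subseteq> coef: subfield_space "(*)" E
  by unfold_locales (auto simp: algebra_simps intro: one_mem diff_mem mult_mem inverse_mem)

context relation_blocks
begin

\<comment> \<open>With multiplication as scaling this rule is associativity reversed, so it loops with \<open>mult.assoc\<close>.\<close>
declare coef.scale_scale [simp del]

text \<open>The relations of x are the multiples of \<open>a\<close>. The vector \<open>a\<close>
  may vanish on I, which happens exactly if x is independent over the whole field; requiring its
  span to lie in \<open>C\<close> will exclude this.\<close>

definition generates :: "'i set \<Rightarrow> ('i \<Rightarrow> 'v) \<Rightarrow> ('i \<Rightarrow> 'f) \<Rightarrow> bool" where
  "generates I x a \<longleftrightarrow>
     comb I a x = 0 \<and> (\<forall>b. comb I b x = 0 \<longrightarrow> (\<exists>c. \<forall>i\<in>I. b i = c * a i))"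

text \<open>The second case does not depend on the generator: nonzero generators differ by a nonzero
  scalar, and \<open>C\<close> is closed under such scalars.\<close>

definition admissible :: "'i set \<Rightarrow> ('i \<Rightarrow> 'v) \<Rightarrow> bool" where
  "admissible I x \<longleftrightarrow>
     w \<and> full.indep I x \<or> (\<exists>a. generates I x a \<and> coef.span_of I a \<in> C)"

lemma full_indep_iff: "full.indep I x \<longleftrightarrow> (\<forall>a. comb I a x = 0 \<longrightarrow> (\<forall>i\<in>I. a i = 0))"
  by (simp add: full.indep_def)

lemma coef_span_scale: "coef.span_of I (\<lambda>i. c * a i) = (*) c ` coef.span_of I a"
proof -
  have "coef.comb I b (\<lambda>i. c * a i) = c * coef.comb I b a" for b
    by (simp add: coef.comb_def sum_distrib_left mult_ac)
  then show ?thesis by (auto simp: coef.span_of_def)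
qed

lemma transport_mem_span: "(\<And>i. i \<in> I \<Longrightarrow> R i j \<in> E) \<Longrightarrow> transport I R a j \<in> coef.span_of I a"
  unfolding coef.span_of_def
  by (rule CollectI, rule exI[of _ "\<lambda>i. R i j"]) (auto simp: transport_def coef.comb_def mult.commute)

text \<open>The coordinate matrices carry the relations of x and y into each other. Since both
  matrices have entries in \<open>E\<close>, each of two corresponding generators has its entries in
  the \<open>E\<close>-span of the other.\<close>

lemma admissible_basis_change:
  assumes fin: "finite I" and x: "indep I x" and y: "indep I y"
    and eq: "span_of I x = span_of I y" and adm: "admissible I x"
  shows "admissible I y"
proof -
  have "x \<in> I \<rightarrow> span_of I y" "y \<in> I \<rightarrow> span_of I x"
    using eq span_of_base[OF fin] by auto
  then obtain R P where
    R: "\<And>i. i \<in> I \<Longrightarrow> x i = comb I (R i) y" "\<And>i. i \<in> I \<Longrightarrow> R i \<in> I \<rightarrow> E" and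
    P: "\<And>i. i \<in> I \<Longrightarrow> y i = comb I (P i) x" "\<And>i. i \<in> I \<Longrightarrow> P i \<in> I \<rightarrow> E"
    using ex_coordinates[of x I y] ex_coordinates[of y I x] by metis
  let ?T = "transport I R" and ?T' = "transport I P"
  have T: "comb I (?T a) y = comb I a x" for a
    by (rule comb_transport) (rule R)
  have T': "comb I (?T' b) x = comb I b y" for b
    by (rule comb_transport) (rule P)
  have inv1: "?T' (?T a) i = a i" if "i \<in> I" for a i
    using fin x R P that by (rule transport_inverse)
  have inv2: "?T (?T' b) i = b i" if "i \<in> I" for b i
    using fin y P R that by (rule transport_inverse)
  from adm show ?thesis
    unfolding admissible_def
  proof (elim disjE conjE exE)
    assume w and ind: "full.indep I x"
    have "b i = 0" if b: "comb I b y = 0" and i: "i \<in> I" for b i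
    proof -
      have "?T' b i = 0" if "i \<in> I" for i
        using ind T'[of b] b that unfolding full_indep_iff by simp
      then have "?T (?T' b) = ?T (\<lambda>i. 0)" by (rule transport_cong)
      then show ?thesis using inv2[OF i, of b] by (simp add: transport_def)
    qed
    then show "w \<and> full.indep I y \<or> (\<exists>a. generates I y a \<and> coef.span_of I a \<in> C)"
      using \<open>w\<close> by (auto simp: full_indep_iff)
  next
    fix a assume a: "generates I x a" "coef.span_of I a \<in> C"
    have "generates I y (?T a)"
      unfolding generates_def
    proof (intro conjI allI impI)
      show "comb I (?T a) y = 0" using a T[of a] by (simp add: generates_def)
      fix b assume "comb I b y = 0"
      then obtain c where "\<forall>i\<in>I. ?T' b i = c * a i"
        using a T'[of b] unfolding generates_def by metis
      then have "?T (?T' b) = ?T (\<lambda>i. c * a i)" by (intro transport_cong) auto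
      then have "\<forall>i\<in>I. b i = c * ?T a i"
        using inv2[of _ b] by (simp add: transport_scale)
      then show "\<exists>c. \<forall>i\<in>I. b i = c * ?T a i" ..
    qed
    moreover have "coef.span_of I (?T a) = coef.span_of I a"
    proof
      have "?T a \<in> I \<rightarrow> coef.span_of I a"
        using R(2) by (intro Pi_I transport_mem_span) auto
      then show "coef.span_of I (?T a) \<subseteq> coef.span_of I a"
        by (rule coef.span_of_minimal[OF coef.E_subspace_span_of])
      have "?T' (?T a) \<in> I \<rightarrow> coef.span_of I (?T a)"
        using P(2) by (intro Pi_I transport_mem_span) auto
      then have "a \<in> I \<rightarrow> coef.span_of I (?T a)" using inv1 by (metis (mono_tags, lifting) Pi_cong)
      then show "coef.span_of I a \<subseteq> coef.span_of I (?T a)"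
        by (rule coef.span_of_minimal[OF coef.E_subspace_span_of])
    qed
    ultimately show "w \<and> full.indep I y \<or> (\<exists>a. generates I y a \<and> coef.span_of I a \<in> C)"
      using a by auto
  qed
qed

text \<open>Two nonzero entries span at most \<open>card E ^ 2\<close> elements, fewer than any
  member of \<open>C\<close> has. The exponent 3 in the locale is chosen for this.\<close>

lemma not_in_C:
  assumes "finite I" "J \<subseteq> I" "card J \<le> 2" "\<And>i. i \<in> I - J \<Longrightarrow> a i = 0"
  shows "coef.span_of I a \<notin> C"
proof
  assume "coef.span_of I a \<in> C"
  then have "card E ^ 3 \<le> card (coef.span_of I a)" by (rule C_card)
  also have "\<dots> = card (coef.span_of J a)"
    using coef.span_of_drop_zeros[OF assms(1,2), of a] assms(4) by simp
  also have "\<dots> \<le> card E ^ card J"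
    using assms finite_subset by (intro coef.card_span_of_le) auto
  finally show False
    using card_field_gt_1 assms(3) power_strict_increasing[of "card J" 3 "card E"] by simp
qed

text \<open>A nontrivial relation over \<open>E\<close> would be a nonzero multiple of the
  generator, whose span would then have no more elements than \<open>E\<close> itself, too few for
  \<open>C\<close>.\<close>

lemma admissible_imp_indep:
  assumes fin: "finite I" and adm: "admissible I x"
  shows "indep I x"
  using adm unfolding admissible_def
proof (elim disjE conjE exE)
  assume "full.indep I x"
  then show ?thesis unfolding full_indep_iff indep_def by blast
next
  fix a assume a: "generates I x a" "coef.span_of I a \<in> C"
  show ?thesis
    unfolding indep_def
  proof (intro ballI impI, rule ccontr)
    fix b i assume b: "b \<in> I \<rightarrow> E" "comb I b x = 0" "i \<in> I" "b i \<noteq> 0"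
    then obtain c where c: "\<forall>i\<in>I. b i = c * a i"
      using a(1) unfolding generates_def by blast
    then have "c \<noteq> 0" using b by auto
    have "coef.span_of I b = (*) c ` coef.span_of I a"
      using c coef.span_of_cong[of I b "\<lambda>i. c * a i"] by (simp add: coef_span_scale)
    then have "card (coef.span_of I a) = card (coef.span_of I b)"
      using \<open>c \<noteq> 0\<close> by (simp add: card_image inj_on_def)
    also have "\<dots> \<le> card E"
    proof (rule card_mono)
      have "coef.E_subspace E"
        using zero_mem add_mem mult_mem by (auto simp: coef.E_subspace_def)
      then show "coef.span_of I b \<subseteq> E" using b by (intro coef.span_of_minimal)
    qed simp
    finally show False
      using C_card[OF a(2)] card_field_gt_1 power_strict_increasing[of 1 3 "card E"] by simp
  qed
qed

text \<open>A nontrivial relation between two entries would be a nonzero multiple of the generator,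
  which would then be supported on two indices. Hence two entries never lie on a common line over
  the field.\<close>

lemma admissible_pair_indep:
  assumes fin: "finite I" and adm: "admissible I x" and ij: "i \<in> I" "j \<in> I" "i \<noteq> j"
    and rel: "scale c (x i) + scale d (x j) = 0"
  shows "c = 0 \<and> d = 0"
proof -
  let ?b = "\<lambda>l. if l = i then c else if l = j then d else 0"
  have "comb I ?b x = comb {i, j} ?b x"
    unfolding comb_def using fin ij by (intro sum.mono_neutral_right) auto
  also have "\<dots> = 0" using ij rel by (simp add: comb_def)
  finally have b: "comb I ?b x = 0" .
  from adm show ?thesis
    unfolding admissible_def
  proof (elim disjE conjE exE)
    assume "full.indep I x"
    then have "\<forall>l\<in>I. ?b l = 0" using b unfolding full_indep_iff by blast
    then show ?thesis using ij by (auto split: if_splits)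
  next
    fix a assume a: "generates I x a" "coef.span_of I a \<in> C"
    then obtain e where e: "\<forall>l\<in>I. ?b l = e * a l"
      using b by (auto simp only: generates_def)
    show ?thesis
    proof (cases "e = 0")
      case True
      then show ?thesis using e ij by (auto split: if_splits)
    next
      case False
      have "a l = 0" if "l \<in> I - {i, j}" for l
      proof -
        have "e * a l = 0" using bspec[OF e, of l] that by (simp split: if_splits)
        then show ?thesis using False by simp
      qed
      then have "coef.span_of I a \<notin> C"
        using fin ij by (intro not_in_C[of I "{i, j}"]) auto
      then show ?thesis using a by simp
    qed
  qed
qed

text \<open>Subtracting a multiple of \<open>a\<close> from a relation clears its coefficient at j,
  so \<open>a\<close> generates all relations exactly if none is left on the other indices. In the
  count this makes the entry at j a function of the others.\<close>

lemma generates_iff_indep: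
  assumes fin: "finite I" and j: "j \<in> I" "a j \<noteq> 0"
  shows "generates I x a \<longleftrightarrow> full.indep (I - {j}) x \<and> comb I a x = 0"
proof -
  have I: "I = insert j (I - {j})" using j by blast
  have split: "comb I b x = scale (b j) (x j) + comb (I - {j}) b x" for b
    using fin by (subst I, subst comb_insert) auto
  show ?thesis
  proof
    assume g: "generates I x a"
    have "b i = 0" if b: "comb (I - {j}) b x = 0" and i: "i \<in> I - {j}" for b i
    proof -
      have "comb I (b(j := 0)) x = 0" using b by (simp add: split)
      then obtain c where c: "\<forall>i\<in>I. (b(j := 0)) i = c * a i"
        using g unfolding generates_def by blast
      then have "(b(j := 0)) j = c * a j" using j by blast
      then have "c = 0" using j by simp
      moreover have "(b(j := 0)) i = c * a i" using c i by blast
      ultimately show ?thesis using i by simp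
    qed
    then show "full.indep (I - {j}) x \<and> comb I a x = 0"
      using g by (auto simp: full_indep_iff generates_def)
  next
    assume r: "full.indep (I - {j}) x \<and> comb I a x = 0"
    show "generates I x a"
      unfolding generates_def
    proof (intro conjI allI impI)
      fix b assume b: "comb I b x = 0"
      let ?c = "b j / a j" let ?d = "\<lambda>i. b i - ?c * a i"
      have "comb I ?d x = 0" using b r by (simp only: comb_diff comb_scale) simp
      moreover have "?d j = 0" using j by simp
      ultimately have "comb (I - {j}) ?d x = 0" by (simp only: split) simp
      then have "\<forall>i\<in>I - {j}. ?d i = 0" using r unfolding full_indep_iff by blast
      then have "b i = ?c * a i" if "i \<in> I" for i
        using that j by (cases "i = j") auto
      then show "\<exists>c. \<forall>i\<in>I. b i = c * a i" by blast
    qed (use r in simp)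
  qed
qed


section \<open>Blocks: bases, intersection with lines, images under linear maps\<close>

definition blocks :: "'v set set" where
  "blocks = {span_of {..<k} x | x. indep {..<k} x \<and> admissible {..<k} x}"

lemma blocks_E_subspace: "B \<in> blocks \<Longrightarrow> E_subspace B"
  by (auto simp: blocks_def E_subspace_span_of)

lemma card_block: "B \<in> blocks \<Longrightarrow> card B = card E ^ k"
  by (auto simp: blocks_def card_span_of)

text \<open>By cardinality an independent k-tuple in B spans B, and admissibility passes to it from
  the defining basis.\<close>

lemma block_basis_admissible:
  assumes B: "B \<in> blocks" and x: "x \<in> {..<k} \<rightarrow> B" "indep {..<k} x"
  shows "admissible {..<k} x" "span_of {..<k} x = B"
proof -
  show sp: "span_of {..<k} x = B"
    using blocks_E_subspace[OF B] x card_block[OF B]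
    by (intro span_of_subspace_eq) (auto simp: card_span_of)
  obtain y where "indep {..<k} y" "admissible {..<k} y" "B = span_of {..<k} y"
    using B by (auto simp: blocks_def)
  then show "admissible {..<k} x"
    using x sp by (intro admissible_basis_change[of _ y x]) auto
qed

text \<open>For c outside \<open>E\<close>, the vectors y and \<open>scale c y\<close> are
  independent over \<open>E\<close> and extend to a basis of B. But they are dependent over the
  field, which no two entries of an admissible tuple are.\<close>

lemma blocks_scattered:
  assumes B: "B \<in> blocks" and y: "y \<in> B" "y \<noteq> 0" "scale c y \<in> B"
  shows "c \<in> E"
proof (rule ccontr)
  assume c: "c \<notin> E"
  define x0 where "x0 = (\<lambda>i::nat. if i = 0 then y else scale c y)"
  have "indep {0} x0"
    using y indep_insert[of "{}" 0 x0] by (simp add: x0_def)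
  moreover have "scale c y \<noteq> scale e y" if "e \<in> E" for e
    using c y that by (auto simp: scale_cancel_right)
  then have "scale c y \<notin> span_of {0} x0"
    by (auto simp: span_of_def comb_def x0_def)
  ultimately have ind: "indep {0, 1} x0"
    using indep_insert[of "{0}" 1 x0] by (simp add: x0_def insert_commute)
  have I: "{0, 1} \<union> {2..<k} = {..<k}" using k_ge_3 by auto
  have "x0 \<in> {0, 1} \<rightarrow> B" using y by (simp add: x0_def)
  moreover have "card {0, 1::nat} + card {2..<k} \<le> k" using k_ge_3 by simp
  ultimately have "\<exists>x\<in>({0, 1} \<union> {2..<k}) \<rightarrow>\<^sub>E B. (\<forall>i\<in>{0, 1}. x i = x0 i) \<and>
      indep ({0, 1} \<union> {2..<k}) x"
    by (intro ex_indep_extension[OF blocks_E_subspace[OF B] card_block[OF B] _ _ ind]) auto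
  then obtain x where x: "x \<in> {..<k} \<rightarrow>\<^sub>E B" "x 0 = x0 0" "x 1 = x0 1" "indep {..<k} x"
    unfolding I by auto
  have "admissible {..<k} x"
    using x by (intro block_basis_admissible[OF B]) auto
  moreover have "scale c (x 0) + scale (- 1) (x 1) = 0"
    using x by (simp add: x0_def)
  ultimately show False
    using admissible_pair_indep[of "{..<k}" x 0 1 c "- 1"] k_ge_3 by simp
qed

text \<open>A field-linear injection neither creates nor destroys relations, so the image of a basis
  keeps the same generator.\<close>

lemma blocks_image:
  assumes B: "B \<in> blocks" and f: "inj f" "\<And>x y. f (x + y) = f x + f y"
    "\<And>c x. f (scale c x) = scale c (f x)"
  shows "f ` B \<in> blocks"
proof -
  obtain x where x: "indep {..<k} x" "admissible {..<k} x" "B = span_of {..<k} x"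
    using B by (auto simp: blocks_def)
  have f0: "f 0 = 0" using f(2)[of 0 0] by simp
  have comb: "comb I a (f \<circ> x) = f (comb I a x)" for I :: "nat set" and a
    unfolding comb_def by (induction I rule: infinite_finite_induct) (simp_all add: f0 f)
  have eq0: "f v = 0 \<longleftrightarrow> v = 0" for v
    using f(1) f0 by (metis injD)
  have "indep {..<k} (f \<circ> x)"
    using x(1) by (simp add: indep_def comb eq0)
  moreover have "admissible {..<k} (f \<circ> x)"
    using x(2) by (simp add: admissible_def generates_def full_indep_iff comb eq0)
  moreover have "f ` B = span_of {..<k} (f \<circ> x)"
    by (auto simp: x(3) span_of_def comb)
  ultimately show ?thesis unfolding blocks_def by blast
qed

section \<open>Counting the blocks through a field-independent pair\<close>

lemma index_split: "{0, 1} \<union> {2..<k} = {..<k}"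
  using k_ge_3 by auto

text \<open>The admissible tuples that start with x0 are sorted by the block they span. Each block
  through the pair contributes all completions of the pair to a basis of it, with k - 2 vectors left
  to choose.\<close>

lemma card_basis_extensions:
  assumes pair: "full.indep {0, 1} x0"
  shows "card {x \<in> {..<k} \<rightarrow>\<^sub>E UNIV. (\<forall>i\<in>{0, 1}. x i = x0 i) \<and> admissible {..<k} x} =
    card {B \<in> blocks. span_of {0, 1} x0 \<subseteq> B} * (\<Prod>i<k - 2. card E ^ k - card E ^ (2 + i))"
proof -
  let ?X = "\<lambda>B. {x \<in> {..<k} \<rightarrow>\<^sub>E B. (\<forall>i\<in>{0, 1}. x i = x0 i) \<and> indep {..<k} x}"
  let ?B = "{B \<in> blocks. span_of {0, 1} x0 \<subseteq> B}"
  have ind: "indep {0, 1} x0"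
    using pair unfolding full_indep_iff indep_def by blast
  have "{x \<in> {..<k} \<rightarrow>\<^sub>E UNIV. (\<forall>i\<in>{0, 1}. x i = x0 i) \<and> admissible {..<k} x} = (\<Union>B\<in>?B. ?X B)"
  proof (intro equalityI subsetI)
    fix x assume x: "x \<in> {x \<in> {..<k} \<rightarrow>\<^sub>E UNIV. (\<forall>i\<in>{0, 1}. x i = x0 i) \<and> admissible {..<k} x}"
    then have i: "indep {..<k} x" by (intro admissible_imp_indep) auto
    let ?S = "span_of {..<k} x"
    have base: "x \<in> {..<k} \<rightarrow> ?S" by (auto intro: span_of_base)
    have "?S \<in> blocks" using x i unfolding blocks_def by blast
    moreover have "x0 i = x i" if "i \<in> {0, 1}" for i
      using x that by (metis (mono_tags, lifting) mem_Collect_eq)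
    then have "span_of {0, 1} x0 = span_of {0, 1} x"
      by (rule span_of_cong)
    moreover have "span_of {0, 1} x \<subseteq> ?S"
      using k_ge_3 by (intro span_of_mono) auto
    moreover have "x \<in> ?X ?S" using x i base by (auto simp: PiE_iff)
    ultimately show "x \<in> (\<Union>B\<in>?B. ?X B)" by auto
  next
    fix x assume "x \<in> (\<Union>B\<in>?B. ?X B)"
    then obtain B where "B \<in> blocks" "x \<in> ?X B" by blast
    then show "x \<in> {x \<in> {..<k} \<rightarrow>\<^sub>E UNIV. (\<forall>i\<in>{0, 1}. x i = x0 i) \<and> admissible {..<k} x}"
      using block_basis_admissible(1)[of B x] by (auto simp: PiE_iff)
  qed
  moreover have "card (\<Union>B\<in>?B. ?X B) = (\<Sum>B\<in>?B. card (?X B))"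
  proof (rule card_UN_disjoint)
    show "finite ?B" "\<forall>B\<in>?B. finite (?X B)" by simp_all
    have sp: "span_of {..<k} x = B" if "B \<in> ?B" "x \<in> ?X B" for x B
      by (rule block_basis_admissible(2)) (use that in \<open>auto simp: PiE_iff\<close>)
    show "\<forall>B\<in>?B. \<forall>B'\<in>?B. B \<noteq> B' \<longrightarrow> ?X B \<inter> ?X B' = {}"
    proof (intro ballI impI, rule ccontr)
      fix B B' assume B: "B \<in> ?B" "B' \<in> ?B" "B \<noteq> B'" "?X B \<inter> ?X B' \<noteq> {}"
      then obtain x where x: "x \<in> ?X B" "x \<in> ?X B'" by blast
      have "B = B'" using sp[OF B(1) x(1)] sp[OF B(2) x(2)] by (rule trans[OF sym])
      then show False using B(3) by simp
    qed
  qed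
  moreover have "card (?X B) = (\<Prod>i<k - 2. card E ^ k - card E ^ (2 + i))" if "B \<in> ?B" for B
  proof -
    have "x0 \<in> {0, 1} \<rightarrow> B"
      using that span_of_base[of "{0, 1}" _ x0] by auto
    then have "card {x \<in> ({0, 1} \<union> {2..<k}) \<rightarrow>\<^sub>E B. (\<forall>i\<in>{0, 1}. x i = x0 i) \<and>
        indep ({0, 1} \<union> {2..<k}) x} =
        (\<Prod>i<card {2..<k}. card B - card E ^ (card {0, 1::nat} + i))"
      using that ind by (intro card_indep_extensions) (auto simp: blocks_E_subspace)
    then show ?thesis using that by (simp only: index_split) (simp add: card_block)
  qed
  ultimately show ?thesis by simp
qed

text \<open>The entry at j is determined by \<open>a\<close> and the rest, and the other k - 1
  entries only have to be independent over the field. Two of them are given, so k - 3 are free;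
  taking j outside the pair leaves x0 unconstrained.\<close>

lemma card_generated_extensions:
  assumes pair: "full.indep {0, 1} x0" and j: "j \<in> {2..<k}" "a j \<noteq> 0"
  shows "card {x \<in> {..<k} \<rightarrow>\<^sub>E UNIV. (\<forall>i\<in>{0, 1}. x i = x0 i) \<and> generates {..<k} x a} =
    (\<Prod>i<k - 3. CARD('v) - CARD('f) ^ (2 + i))"
proof -
  let ?I = "{0, 1} \<union> ({2..<k} - {j})"
  let ?Y = "{x \<in> ?I \<rightarrow>\<^sub>E UNIV. (\<forall>i\<in>{0, 1}. x i = x0 i) \<and> full.indep ?I x}"
  let ?X = "{x \<in> {..<k} \<rightarrow>\<^sub>E UNIV. (\<forall>i\<in>{0, 1}. x i = x0 i) \<and> generates {..<k} x a}"
  let ?g = "\<lambda>x. x(j := scale (- inverse (a j)) (comb ?I a x))"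
  have I: "{..<k} - {j} = ?I" "{..<k} = insert j ?I" "j \<notin> ?I" and jk: "j \<in> {..<k}"
    using j k_ge_3 by auto
  have gen: "generates {..<k} x a \<longleftrightarrow> full.indep ?I x \<and> comb {..<k} a x = 0" for x
    using generates_iff_indep[of "{..<k}" j a x] j jk I(1) by simp
  have split: "comb {..<k} a x = scale (a j) (x j) + comb ?I a x" for x
    by (subst I(2), rule comb_insert) (use I(3) in auto)
  have det: "comb {..<k} a x = 0 \<longleftrightarrow> x j = scale (- inverse (a j)) (comb ?I a x)" for x
  proof
    assume "comb {..<k} a x = 0"
    then have e: "comb ?I a x = - scale (a j) (x j)"
      by (simp add: split eq_neg_iff_add_eq_0 add.commute)
    show "x j = scale (- inverse (a j)) (comb ?I a x)"
      unfolding e using j by simp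
  qed (use j in \<open>simp add: split\<close>)
  have "?X = ?g ` ?Y"
  proof (intro equalityI subsetI)
    fix x assume x: "x \<in> ?X"
    let ?y = "restrict x ?I"
    have "full.indep ?I ?y" "comb ?I a ?y = comb ?I a x"
      using x gen full.indep_cong[of ?I ?y x] comb_cong[of ?I a a ?y x] by auto
    moreover have "x = ?y(j := x j)"
      using x I(2) by (fastforce simp: fun_eq_iff restrict_def PiE_iff extensional_def)
    ultimately have "x = ?g ?y" using x gen det[of x] by simp
    moreover have "?y \<in> ?Y" using x \<open>full.indep ?I ?y\<close> by auto
    ultimately show "x \<in> ?g ` ?Y" by blast
  next
    fix x assume "x \<in> ?g ` ?Y"
    then obtain y where y: "y \<in> ?Y" "x = ?g y" by blast
    have e: "x i = y i" if "i \<in> ?I" for i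
      using y(2) that I(3) by (simp only: fun_upd_apply) metis
    have "full.indep ?I x" "comb ?I a x = comb ?I a y"
      using y(1) full.indep_cong[of ?I x y, OF e] comb_cong[of ?I a a x y, OF _ e] by auto
    then have "generates {..<k} x a"
      using gen det[of x] y(2) by simp
    moreover have "x \<in> {..<k} \<rightarrow>\<^sub>E UNIV"
      unfolding I(2) using y by (auto simp: PiE_iff extensional_def)
    moreover have "\<forall>i\<in>{0, 1}. x i = x0 i" using y j by auto
    ultimately show "x \<in> ?X" by blast
  qed
  moreover have "inj_on ?g ?Y"
  proof (rule inj_onI)
    fix y z assume y: "y \<in> ?Y" "z \<in> ?Y" "?g y = ?g z"
    then have "(y, scale (- inverse (a j)) (comb ?I a y)) = (z, scale (- inverse (a j)) (comb ?I a z))"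
      by (intro inj_onD[OF inj_on_extend[OF I(3)]]) (auto simp: PiE_iff)
    then show "y = z" by simp
  qed
  ultimately have "card ?X = card ?Y" by (simp add: card_image)
  also have "\<dots> = (\<Prod>i<card ({2..<k} - {j}). CARD('v) - CARD('f) ^ (card {0, 1::nat} + i))"
    using pair full.E_subspace_UNIV by (intro full.card_indep_extensions) auto
  finally show ?thesis using j by simp
qed

text \<open>The generators are the nonzero multiples of \<open>a\<close>. The zero multiple drops
  out because its span is not in \<open>C\<close>.\<close>

lemma card_generators:
  assumes a: "generates {..<k} x a" "coef.span_of {..<k} a \<in> C"
  shows "card {b \<in> {..<k} \<rightarrow>\<^sub>E UNIV. coef.span_of {..<k} b \<in> C \<and> generates {..<k} x b} = CARD('f) - 1"
proof -
  let ?h = "\<lambda>c. restrict (\<lambda>i. c * a i) {..<k}"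
  have ex: "\<exists>j\<in>{..<k}. b j \<noteq> 0" if "coef.span_of {..<k} b \<in> C" for b
    using that not_in_C[of "{..<k}" "{}" b] by auto
  have sp: "coef.span_of {..<k} (?h c) = (*) c ` coef.span_of {..<k} a" for c
    using coef.span_of_cong[of "{..<k}" "?h c" "\<lambda>i. c * a i"] by (simp add: coef_span_scale)
  have cb: "comb {..<k} (?h c) x = scale c (comb {..<k} a x)" for c
    using comb_cong[of "{..<k}" "?h c" "\<lambda>i. c * a i" x x] by (simp add: comb_scale)
  have "{b \<in> {..<k} \<rightarrow>\<^sub>E UNIV. coef.span_of {..<k} b \<in> C \<and> generates {..<k} x b} = ?h ` (UNIV - {0})"
  proof (intro equalityI subsetI)
    fix b assume b: "b \<in> {b \<in> {..<k} \<rightarrow>\<^sub>E UNIV. coef.span_of {..<k} b \<in> C \<and> generates {..<k} x b}"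
    then obtain c where c: "\<forall>i\<in>{..<k}. b i = c * a i"
      using a unfolding generates_def by blast
    obtain j where "j \<in> {..<k}" "b j \<noteq> 0" using ex b by blast
    then have "c \<noteq> 0" using c by auto
    moreover have "b = ?h c"
      using b c by (auto simp: fun_eq_iff restrict_def PiE_iff extensional_def)
    ultimately show "b \<in> ?h ` (UNIV - {0})" by blast
  next
    fix b assume "b \<in> ?h ` (UNIV - {0})"
    then obtain c where c: "c \<noteq> 0" "b = ?h c" by blast
    have "generates {..<k} x b"
      unfolding generates_def
    proof (intro conjI allI impI)
      show "comb {..<k} b x = 0" using a c cb by (simp add: generates_def)
      fix d assume "comb {..<k} d x = 0"
      then obtain e where "\<forall>i\<in>{..<k}. d i = e * a i"
        using a unfolding generates_def by blast
      then have "\<forall>i\<in>{..<k}. d i = (e / c) * b i" using c by simp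
      then show "\<exists>e. \<forall>i\<in>{..<k}. d i = e * b i" by blast
    qed
    moreover have "coef.span_of {..<k} b \<in> C" using c sp a C_scale by simp
    ultimately show "b \<in> {b \<in> {..<k} \<rightarrow>\<^sub>E UNIV. coef.span_of {..<k} b \<in> C \<and> generates {..<k} x b}"
      using c by auto
  qed
  moreover have "inj_on ?h (UNIV - {0})"
  proof (rule inj_onI)
    fix c d assume e: "?h c = ?h d"
    obtain j where j: "j \<in> {..<k}" "a j \<noteq> 0" using ex a by blast
    have "?h c j = ?h d j" using e by simp
    then show "c = d" using j by simp
  qed
  ultimately show ?thesis by (simp add: card_image card_Diff_subset)
qed

text \<open>The tuples with a relation come from counting pairs of a tuple and a generator in two
  ways. The number \<open>CARD('f) - 1\<close> of generators per tuple stays as a factor to avoid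
  division.\<close>

lemma card_admissible_extensions:
  assumes pair: "full.indep {0, 1} x0"
  shows "(CARD('f) - 1) *
      card {x \<in> {..<k} \<rightarrow>\<^sub>E UNIV. (\<forall>i\<in>{0, 1}. x i = x0 i) \<and> admissible {..<k} x} =
    (CARD('f) - 1) * (if w then \<Prod>i<k - 2. CARD('v) - CARD('f) ^ (2 + i) else 0) +
    card {a \<in> {..<k} \<rightarrow>\<^sub>E UNIV. coef.span_of {..<k} a \<in> C} *
      (\<Prod>i<k - 3. CARD('v) - CARD('f) ^ (2 + i))"
proof -
  let ?Z = "{x \<in> {..<k} \<rightarrow>\<^sub>E UNIV. \<forall>i\<in>{0, 1}. x i = x0 i}"
  let ?A = "{a \<in> {..<k} \<rightarrow>\<^sub>E UNIV. coef.span_of {..<k} a \<in> C}"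
  let ?X1 = "{x \<in> ?Z. w \<and> full.indep {..<k} x}"
  let ?X2 = "{x \<in> ?Z. \<exists>a. generates {..<k} x a \<and> coef.span_of {..<k} a \<in> C}"
  \<comment> \<open>Two entries alone cannot span a member of \<open>C\<close>, so an index whose
    entry is forced exists away from the prescribed pair.\<close>
  have ex: "\<exists>j\<in>{2..<k}. a j \<noteq> 0" if "coef.span_of {..<k} a \<in> C" for a
  proof (rule ccontr)
    assume "\<not> ?thesis"
    then have "a j = 0" if "j \<in> {..<k} - {0, 1}" for j
      using that index_split by (metis Diff_iff Un_iff)
    then show False
      using \<open>coef.span_of {..<k} a \<in> C\<close> not_in_C[of "{..<k}" "{0, 1}" a] k_ge_3 by auto
  qed
  have disj: "?X1 \<inter> ?X2 = {}"
  proof -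
    have False if h: "full.indep {..<k} x" "generates {..<k} x a" "coef.span_of {..<k} a \<in> C" for x a
    proof -
      obtain j where "j \<in> {2..<k}" "a j \<noteq> 0" using ex[OF h(3)] by blast
      then show False using h unfolding full_indep_iff generates_def by auto
    qed
    then show ?thesis by blast
  qed
  have "{x \<in> {..<k} \<rightarrow>\<^sub>E UNIV. (\<forall>i\<in>{0, 1}. x i = x0 i) \<and> admissible {..<k} x} = ?X1 \<union> ?X2"
    by (auto simp: admissible_def)
  then have total: "card {x \<in> {..<k} \<rightarrow>\<^sub>E UNIV. (\<forall>i\<in>{0, 1}. x i = x0 i) \<and> admissible {..<k} x} =
      card ?X1 + card ?X2"
    using card_Un_disjoint[OF _ _ disj] by simp
  have X1: "card ?X1 = (if w then \<Prod>i<k - 2. CARD('v) - CARD('f) ^ (2 + i) else 0)"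
  proof (cases w)
    case True
    have "card {x \<in> ({0, 1} \<union> {2..<k}) \<rightarrow>\<^sub>E UNIV. (\<forall>i\<in>{0, 1}. x i = x0 i) \<and>
        full.indep ({0, 1} \<union> {2..<k}) x} =
        (\<Prod>i<card {2..<k}. CARD('v) - CARD('f) ^ (card {0, 1::nat} + i))"
      using pair full.E_subspace_UNIV by (intro full.card_indep_extensions) auto
    then show ?thesis using True by (simp only: index_split) (simp add: conj_assoc)
  qed simp
  have X2: "card ?A * (\<Prod>i<k - 3. CARD('v) - CARD('f) ^ (2 + i)) = card ?X2 * (CARD('f) - 1)"
  proof -
    define A Z X2 where "A = ?A" and "Z = ?Z" and "X2 = ?X2"
    have ext: "card {x \<in> Z. generates {..<k} x a} = (\<Prod>i<k - 3. CARD('v) - CARD('f) ^ (2 + i))"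
      if a: "a \<in> A" for a
    proof -
      have "coef.span_of {..<k} a \<in> C" using a by (simp add: A_def)
      then obtain j where "j \<in> {2..<k}" "a j \<noteq> 0" using ex by blast
      then show ?thesis
        using card_generated_extensions[OF pair, of j a] by (simp add: Z_def conj_assoc)
    qed
    have gen: "card {a \<in> A. generates {..<k} x a} = (if x \<in> X2 then CARD('f) - 1 else 0)"
      if x: "x \<in> Z" for x
    proof (cases "x \<in> X2")
      case True
      then obtain a where "generates {..<k} x a" "coef.span_of {..<k} a \<in> C"
        by (auto simp: X2_def)
      then show ?thesis using True by (simp add: A_def card_generators conj_assoc)
    next
      case False
      then have "{a \<in> A. generates {..<k} x a} = {}"
        using x by (auto simp: A_def X2_def Z_def)
      then show ?thesis using False by (simp only: card.empty if_False)
    qed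
    have fin: "finite A" "finite Z" "finite X2" and sub: "X2 \<subseteq> Z"
      by (auto simp: A_def Z_def X2_def)
    have "card A * (\<Prod>i<k - 3. CARD('v) - CARD('f) ^ (2 + i)) =
        (\<Sum>a\<in>A. card {x \<in> Z. generates {..<k} x a})"
      by (simp add: ext)
    also have "\<dots> = (\<Sum>a\<in>A. \<Sum>x\<in>Z. if generates {..<k} x a then 1 else 0)"
      using fin by (simp add: sum.If_cases Int_def)
    also have "\<dots> = (\<Sum>x\<in>Z. \<Sum>a\<in>A. if generates {..<k} x a then 1 else 0)"
      by (rule sum.swap)
    also have "\<dots> = (\<Sum>x\<in>Z. card {a \<in> A. generates {..<k} x a})"
      using fin by (simp add: sum.If_cases Int_def)
    also have "\<dots> = (\<Sum>x\<in>Z. if x \<in> X2 then CARD('f) - 1 else 0)"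
      by (simp add: gen)
    also have "\<dots> = card X2 * (CARD('f) - 1)"
      using fin sub by (simp add: sum.If_cases Int_absorb1)
    finally show ?thesis unfolding A_def X2_def .
  qed
  show ?thesis
    unfolding total X1 X2 distrib_left by (simp only: mult.commute)
qed

text \<open>Coefficient vectors are sorted by the space they span; spaces of dimension above k
  contribute 0.\<close>

lemma card_relation_vectors:
  assumes d: "\<And>U. U \<in> C \<Longrightarrow> card U = card E ^ d U"
  shows "real (card {a \<in> {..<k} \<rightarrow>\<^sub>E UNIV. coef.span_of {..<k} a \<in> C}) = (\<Sum>U\<in>C. qfall (card E) k (d U))"
proof -
  have "{a \<in> {..<k} \<rightarrow>\<^sub>E UNIV. coef.span_of {..<k} a \<in> C} =
      (\<Union>U\<in>C. {a \<in> {..<k} \<rightarrow>\<^sub>E UNIV. coef.span_of {..<k} a = U})"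
    by auto
  also have "card \<dots> = (\<Sum>U\<in>C. card {a \<in> {..<k} \<rightarrow>\<^sub>E UNIV. coef.span_of {..<k} a = U})"
    by (rule card_UN_disjoint) auto
  also have "real \<dots> = (\<Sum>U\<in>C. qfall (card E) k (d U))"
    unfolding of_nat_sum
    by (intro sum.cong refl) (simp add: coef.card_spanning_families[OF C_E_subspace d])
  finally show ?thesis .
qed

text \<open>The number of admissible extensions of the pair is divided by the number of completions
  inside one block. The result no longer mentions x0, which is the design property.\<close>

theorem card_blocks_containing:
  fixes x0 :: "nat \<Rightarrow> 'v"
  assumes pair: "full.indep {0, 1} x0" and V: "CARD('v) = CARD('f) ^ m" and m: "2 \<le> m"
    and d: "\<And>U. U \<in> C \<Longrightarrow> card U = card E ^ d U"
  shows "real (card {B \<in> blocks. span_of {0, 1} x0 \<subseteq> B}) =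
    ((if w then \<Prod>j=2..<k. real CARD('f) ^ m - real CARD('f) ^ j else 0) +
     (\<Sum>U\<in>C. qfall (card E) k (d U)) / (real CARD('f) - 1) *
       (\<Prod>j=2..<k - 1. real CARD('f) ^ m - real CARD('f) ^ j)) /
    (\<Prod>j=2..<k. real (card E) ^ k - real (card E) ^ j)"
proof -
  let ?Q = "CARD('f)" and ?q = "card E"
  have Q: "?Q > 1" using full.card_field_gt_1 .
  have shift: "(\<Prod>i<n - 2. f (2 + i)) = (\<Prod>j=2..<n. f j)" for f :: "nat \<Rightarrow> real" and n
    by (rule prod.reindex_bij_witness[of _ "\<lambda>j. j - 2" "\<lambda>i. 2 + i"]) auto
  let ?N = "real (card {B \<in> blocks. span_of {0, 1} x0 \<subseteq> B})"
  let ?P = "\<Prod>j=2..<k. real ?q ^ k - real ?q ^ j"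
  let ?R = "\<lambda>n. \<Prod>j=2..<n. real ?Q ^ m - real ?Q ^ j"
  have R: "real (\<Prod>i<n - 2. CARD('v) - ?Q ^ (2 + i)) = ?R n" for n
    unfolding V using of_nat_prod_power_diff[OF Q m, of "n - 2"] shift[of "\<lambda>j. real ?Q ^ m - real ?Q ^ j" n] by simp
  have P: "real (\<Prod>i<k - 2. ?q ^ k - ?q ^ (2 + i)) = ?P"
    using of_nat_prod_power_diff[OF card_field_gt_1, of 2 k "k - 2"] k_ge_3 shift[of "\<lambda>j. real ?q ^ k - real ?q ^ j" k] by simp
  have P0: "?P \<noteq> 0"
    using card_field_gt_1 by (auto simp: prod_zero_iff)
  \<comment> \<open>The one forced vector shortens the product over the ambient space by a factor,
    so the general product is used with k - 1 in place of k.\<close>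
  have "k - 3 = k - 1 - 2" by simp
  then have R1: "real (\<Prod>i<k - 3. CARD('v) - ?Q ^ (2 + i)) = ?R (k - 1)"
    using R[of "k - 1"] by presburger
  have A: "real (card {a \<in> {..<k} \<rightarrow>\<^sub>E UNIV. coef.span_of {..<k} a \<in> C}) =
      (\<Sum>U\<in>C. qfall ?q k (d U))"
    by (rule card_relation_vectors) (rule d)
  have "real ((?Q - 1) * (card {B \<in> blocks. span_of {0, 1} x0 \<subseteq> B} *
      (\<Prod>i<k - 2. ?q ^ k - ?q ^ (2 + i)))) =
    real ((?Q - 1) * (if w then \<Prod>i<k - 2. CARD('v) - ?Q ^ (2 + i) else 0) +
      card {a \<in> {..<k} \<rightarrow>\<^sub>E UNIV. coef.span_of {..<k} a \<in> C} *
      (\<Prod>i<k - 3. CARD('v) - ?Q ^ (2 + i)))"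
    using card_admissible_extensions[OF pair] card_basis_extensions[OF pair] by simp
  then have "(real ?Q - 1) * (?N * ?P) =
      (real ?Q - 1) * (if w then ?R k else 0) + (\<Sum>U\<in>C. qfall ?q k (d U)) * ?R (k - 1)"
    unfolding of_nat_mult of_nat_add P R1 A if_distrib[of real] R
    using Q by (simp add: of_nat_diff)
  moreover have "n = (r + s / c * t) / p" if "c * (n * p) = c * r + s * t" "c \<noteq> 0" "p \<noteq> 0"
    for n p c r s t :: real
    using that by (simp add: field_simps)
  ultimately show ?thesis
    using Q P0 by simp
qed

end

subsection \<open>Subfields of a finite field\<close>

lemma moebius_prime_mult:
  assumes p: "prime p" and e: "squarefree e" "\<not> p dvd e"
  shows "squarefree (p * e)" "moebius (p * e) = - moebius e"
proof -
  have "coprime p e" using p e by (simp add: prime_imp_coprime)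
  then show sq: "squarefree (p * e)"
    using squarefree_prime[OF p] e by (intro squarefree_mult_coprime)
  have e0: "e \<noteq> 0" using e(1) by (metis not_squarefree_0)
  have "p \<notin> prime_factors e" using e by auto
  moreover have "prime_factors (p * e) = insert p (prime_factors e)"
    using p e0 prime_factors_product[of p e] prime_prime_factors[OF p] by auto
  ultimately show "moebius (p * e) = - moebius e"
    using sq e by (simp add: moebius_def)
qed

text \<open>Divisors that are not squarefree contribute 0. For a prime p dividing n, the others pair
  off as d and p d with p not dividing d, with opposite signs.\<close>

lemma sum_moebius_divisors:
  assumes "n > 0"
  shows "(\<Sum>d | d dvd n. moebius d) = (if n = 1 then 1 else 0)"
proof (cases "n = 1")
  case True
  then show ?thesis by (simp add: moebius_def)
next
  case False
  then obtain p where p: "prime p" "p dvd n"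
    using prime_factor_nat by blast
  let ?S = "{d. d dvd n \<and> squarefree d \<and> \<not> p dvd d}"
  let ?S' = "{d. d dvd n \<and> squarefree d \<and> p dvd d}"
  have fin: "finite {d. d dvd n}" using assms by simp
  have "(\<Sum>d | d dvd n. moebius d) = (\<Sum>d\<in>?S \<union> ?S'. moebius d)"
    by (rule sum.mono_neutral_right[OF fin]) (auto simp: moebius_def)
  also have "\<dots> = (\<Sum>d\<in>?S. moebius d) + (\<Sum>d\<in>?S'. moebius d)"
    by (rule sum.union_disjoint) (auto intro: finite_subset[OF _ fin])
  also have "?S' = (*) p ` ?S"
  proof (intro equalityI subsetI)
    fix d assume d: "d \<in> ?S'"
    then obtain e where e: "d = p * e" by (auto elim: dvdE)
    have "\<not> p dvd e"
    proof
      assume "p dvd e"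
      then have "p ^ 2 dvd d" using e by (auto simp: power2_eq_square elim!: dvdE)
      then show False using d p squarefreeD[of d p] by auto
    qed
    moreover have "e dvd n" using d e dvd_mult_right by blast
    moreover have "squarefree e" using d e squarefree_multD by auto
    ultimately show "d \<in> (*) p ` ?S" using e by blast
  next
    fix d assume "d \<in> (*) p ` ?S"
    then obtain e where e: "d = p * e" "e dvd n" "squarefree e" "\<not> p dvd e" by blast
    then have "coprime p e" using p by (simp add: prime_imp_coprime)
    then have "p * e dvd n" using p e by (simp add: divides_mult)
    then show "d \<in> ?S'" using e moebius_prime_mult(1)[OF p(1)] by auto
  qed
  also have "(\<Sum>d\<in>(*) p ` ?S. moebius d) = (\<Sum>e\<in>?S. - moebius e)"
    using p by (subst sum.reindex) (auto simp: inj_on_def moebius_prime_mult intro!: sum.cong)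
  finally show ?thesis using False by (simp add: sum_negf)
qed

text \<open>After interchanging the sums, the coefficient of \<open>e s\<close> is the sum of the
  Moebius values over the divisors of s/u, which vanishes except for s = u.\<close>

lemma moebius_inversion:
  fixes e :: "nat \<Rightarrow> real"
  assumes "g > 0" "u dvd g"
  shows "(\<Sum>t | u dvd t \<and> t dvd g. of_int (moebius (t div u)) * (\<Sum>s | t dvd s \<and> s dvd g. e s)) = e u"
proof -
  let ?D = "{t. u dvd t \<and> t dvd g}"
  have u: "u > 0" using assms by (auto intro: Nat.gr0I)
  have fin: "finite {t. t dvd g}" using assms by simp
  then have finD: "finite ?D" by (rule rev_finite_subset) auto
  have inner: "(\<Sum>t | t \<in> ?D \<and> t dvd s. of_int (moebius (t div u))) = (if s = u then 1 else 0 :: real)"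
    if s: "s \<in> ?D" for s
  proof -
    obtain v where v: "s = u * v" using s by blast
    have v0: "v > 0" using s v assms by (auto intro!: Nat.gr0I)
    have "{t. t \<in> ?D \<and> t dvd s} = (*) u ` {d. d dvd v}"
      using s v u dvd_trans by (auto elim!: dvdE simp: mult.assoc)
    then have "(\<Sum>t | t \<in> ?D \<and> t dvd s. of_int (moebius (t div u))) =
        (\<Sum>d | d dvd v. of_int (moebius d) :: real)"
      using u by (simp add: sum.reindex inj_on_def)
    also have "\<dots> = of_int (\<Sum>d | d dvd v. moebius d)" by simp
    also have "\<dots> = (if s = u then 1 else 0)"
      using sum_moebius_divisors[OF v0] v u by simp
    finally show ?thesis .
  qed
  have "(\<Sum>t\<in>?D. of_int (moebius (t div u)) * (\<Sum>s | t dvd s \<and> s dvd g. e s)) =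
      (\<Sum>t\<in>?D. \<Sum>s | s \<in> ?D \<and> t dvd s. of_int (moebius (t div u)) * e s)"
  proof (rule sum.cong[OF refl])
    fix t assume t: "t \<in> ?D"
    have "{s. t dvd s \<and> s dvd g} = {s. s \<in> ?D \<and> t dvd s}" using t dvd_trans by blast
    then show "of_int (moebius (t div u)) * (\<Sum>s | t dvd s \<and> s dvd g. e s) =
        (\<Sum>s | s \<in> ?D \<and> t dvd s. of_int (moebius (t div u)) * e s)"
      by (simp add: sum_distrib_left)
  qed
  also have "\<dots> = (\<Sum>s\<in>?D. \<Sum>t | t \<in> ?D \<and> t dvd s. of_int (moebius (t div u)) * e s)"
    by (rule sum.swap_restrict[OF finD finD])
  also have "\<dots> = (\<Sum>s\<in>?D. if s = u then e s else 0)"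
  proof (rule sum.cong[OF refl])
    fix s assume s: "s \<in> ?D"
    show "(\<Sum>t | t \<in> ?D \<and> t dvd s. of_int (moebius (t div u)) * e s) = (if s = u then e s else 0)"
      unfolding sum_distrib_right[symmetric] inner[OF s] by simp
  qed
  also have "\<dots> = e u" using assms finD by simp
  finally show ?thesis .
qed

text \<open>Numerator and denominator give off the same powers Q^i; \<open>b \<le> a\<close> keeps
  the exponents a - i exact.\<close>

lemma gauss_binomial_eq_qfall:
  assumes Q: "Q > 1" and ba: "b \<le> a"
  shows "gauss_binomial Q a b = qfall Q a b / qfall Q b b"
proof -
  have split: "qfall Q n b = (\<Prod>i<b. real Q ^ i) * (\<Prod>i<b. real Q ^ (n - i) - 1)" if "b \<le> n" for n
  proof -
    have "qfall Q n b = (\<Prod>i<b. real Q ^ i * (real Q ^ (n - i) - 1))"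
      unfolding qfall_def using that
      by (intro prod.cong refl) (simp add: algebra_simps flip: power_add)
    then show ?thesis by (simp add: prod.distrib)
  qed
  have e: "(\<Prod>i<b. real Q ^ (b - i) - 1) = (\<Prod>i<b. real Q ^ (i + 1) - 1)"
    by (rule prod.reindex_bij_witness[where i = "\<lambda>i. b - Suc i" and j = "\<lambda>i. b - Suc i"])
       (auto simp: Suc_diff_Suc)
  have "(\<Prod>i<b. real Q ^ i) \<noteq> 0" using Q by simp
  then show ?thesis
    unfolding split[OF ba] split[OF order_refl] gauss_binomial_def prod_dividef e
    by (rule nonzero_mult_divide_mult_cancel_left[symmetric])
qed

section \<open>Subfields as root sets of polynomials\<close>

lemma card_power_eq_le:
  fixes c :: "'f::{field,finite}"
  assumes "n > 0"
  shows "card {x. x ^ n = c} \<le> n"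
proof -
  let ?p = "monom 1 n + [:- c:]"
  have deg: "degree ?p = n"
    using assms by (simp add: degree_add_eq_left degree_monom_eq)
  then have "?p \<noteq> 0" using assms by auto
  then show ?thesis
    using card_poly_roots_bound[of ?p] deg by (simp add: poly_monom)
qed

context subfield_space
begin

text \<open>Multiplication by x permutes the nonzero elements of \<open>E\<close>; comparing their
  products gives Fermat's theorem for \<open>E\<close>.\<close>

lemma power_card_pred:
  assumes "x \<in> E" "x \<noteq> 0"
  shows "x ^ (card E - 1) = 1"
proof -
  have "(\<Prod>y\<in>E - {0}. x * y) = (\<Prod>y\<in>E - {0}. y)"
    by (rule prod.reindex_bij_witness[of _ "\<lambda>y. inverse x * y" "\<lambda>y. x * y"])
       (use assms in \<open>auto intro: mult_mem inverse_mem\<close>)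
  then have "x ^ card (E - {0}) * \<Prod>(E - {0}) = \<Prod>(E - {0})"
    by (simp add: prod.distrib)
  moreover have "\<Prod>(E - {0}) \<noteq> 0" by simp
  ultimately show ?thesis
    using zero_mem by (simp add: card_Diff_subset)
qed

lemma power_card_eq:
  assumes "x \<in> E"
  shows "x ^ card E = x"
proof (cases "x = 0")
  case False
  then show ?thesis
    using power_card_pred[OF assms] card_field_gt_1 power_minus_mult[of "card E" x] by simp
qed (use card_field_gt_1 in simp)

end

text \<open>The roots of X^Q - X. For a prime power Q of which \<open>CARD('f)\<close> is a positive
  power, this is the unique subfield with Q elements.\<close>

definition fixed_field :: "nat \<Rightarrow> 'f::field set" where
  "fixed_field Q = {x. x ^ Q = x}"

lemma card_fixed_field_le:
  assumes "Q > 1"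
  shows "card (fixed_field Q :: 'f::{field,finite} set) \<le> Q"
proof -
  let ?p = "monom 1 Q + [:0, - 1 :: 'f:]"
  have deg: "degree ?p = Q"
    using assms by (simp add: degree_add_eq_left degree_monom_eq)
  then have "?p \<noteq> 0" using assms by auto
  moreover have "fixed_field Q = {x :: 'f. poly ?p x = 0}"
    by (auto simp: fixed_field_def poly_monom)
  ultimately show ?thesis
    using card_poly_roots_bound[of ?p] deg by simp
qed

lemma power_pow_fixed: "(x :: 'f::field) ^ Q = x \<Longrightarrow> x ^ (Q ^ n) = x"
  by (induction n) (simp_all add: power_mult)

text \<open>The \<open>(n - 1) / (Q - 1)\<close>-th power maps the nonzero elements to the roots of \<open>X\<^sup>Q\<^sup>-\<^sup>1 - 1\<close>, with
  fibres of size at most \<open>(n - 1) / (Q - 1)\<close>. This forces enough roots.\<close>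
lemma card_fixed_field:
  assumes Q: "Q > 1" and n: "CARD('f::{field,finite}) = Q ^ s" "s > 0"
  shows "card (fixed_field Q :: 'f set) = Q"
proof -
  interpret K: subfield_space "(*) :: 'f \<Rightarrow> 'f \<Rightarrow> 'f" UNIV
    by unfold_locales (auto simp: algebra_simps)
  let ?R = "{y :: 'f. y ^ (Q - 1) = 1}"
  obtain c where c: "Q ^ s - 1 = (Q - 1) * c"
  proof -
    have "int Q - 1 dvd int Q ^ s - 1"
      by (simp add: power_diff_1_eq)
    then have "int (Q - 1) dvd int (Q ^ s - 1)"
      using Q by (simp add: of_nat_diff)
    then show ?thesis using that by (metis dvdE int_dvd_int_iff)
  qed
  have "Q ^ s > 1" using Q n(2) by (rule one_less_power)
  then have c0: "c > 0" using c by (auto intro: Nat.gr0I)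
  have "UNIV - {0 :: 'f} \<subseteq> (\<Union>y\<in>?R. {x. x ^ c = y})"
  proof
    fix x :: 'f assume "x \<in> UNIV - {0}"
    then have "x ^ (Q ^ s - 1) = 1" using K.power_card_pred[of x] n by simp
    then have "x ^ (c * (Q - 1)) = 1" by (simp only: c mult.commute)
    then show "x \<in> (\<Union>y\<in>?R. {x. x ^ c = y})"
      by (simp flip: power_mult)
  qed
  then have "card (UNIV - {0 :: 'f}) \<le> card (\<Union>y\<in>?R. {x. x ^ c = y})"
    by (intro card_mono) auto
  also have "\<dots> \<le> (\<Sum>y\<in>?R. card {x. x ^ c = y})"
    by (intro card_UN_le) auto
  also have "\<dots> \<le> (\<Sum>y\<in>?R. c)"
    by (intro sum_mono card_power_eq_le c0)
  finally have "Q ^ s - 1 \<le> card ?R * c"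
    using n by (simp add: card_Diff_subset)
  then have "(Q - 1) * c \<le> card ?R * c" by (simp only: c)
  then have "Q - 1 \<le> card ?R" using c0 by simp
  moreover have "insert 0 ?R \<subseteq> fixed_field Q"
  proof
    fix y assume y: "y \<in> insert 0 ?R"
    have "y ^ Q = y ^ (Q - 1) * y" using Q by (intro power_minus_mult[symmetric]) simp
    then show "y \<in> fixed_field Q" using y unfolding fixed_field_def by force
  qed
  then have "card (insert 0 ?R) \<le> card (fixed_field Q :: 'f set)"
    by (intro card_mono) auto
  moreover have "0 \<notin> ?R" using Q by (simp add: zero_power)
  ultimately have "Q \<le> card (fixed_field Q :: 'f set)" by simp
  then show ?thesis using card_fixed_field_le[OF Q, where 'f = 'f] by simp
qed

text \<open>Adding 1 to every element permutes the field and so preserves the sum of all elements;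
  hence \<open>CARD('f)\<close> times 1 is 0.\<close>

lemma CHAR_dvd_card_UNIV: "CHAR('f::{field,finite}) dvd CARD('f)"
proof -
  have "(\<Sum>x\<in>UNIV. x + 1) = (\<Sum>x\<in>UNIV. x :: 'f)"
    by (rule sum.reindex_bij_witness[of _ "\<lambda>x. x - 1" "\<lambda>x. x + 1"]) auto
  then have "of_nat CARD('f) = (0 :: 'f)" by (simp add: sum.distrib)
  then show ?thesis by (simp only: of_nat_eq_0_iff_char_dvd)
qed

text \<open>The characteristic is the prime p of which Q is a power, so raising to the power Q is an
  iterated Frobenius map and additive.\<close>

lemma subfield_fixed_field:
  assumes Q: "primepow Q" and n: "CARD('f::{field,finite}) = Q ^ s" "s > 0"
  shows "subfield_space ((*) :: 'f \<Rightarrow> 'f \<Rightarrow> 'f) (fixed_field Q)"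
proof -
  obtain p e where p: "prime p" "e > 0" "Q = p ^ e"
    using Q by (auto simp: primepow_def)
  have "prime CHAR('f)"
    using prime_CHAR_semidom[where 'a = 'f] finite_imp_CHAR_pos[where 'a = 'f] by simp
  moreover have "CHAR('f) dvd p ^ (e * s)"
    using CHAR_dvd_card_UNIV[where 'f = 'f] by (simp add: n p power_mult)
  ultimately have "CHAR('f) = p"
    using p prime_dvd_power primes_dvd_imp_eq by metis
  then have add: "(x + y) ^ Q = x ^ Q + y ^ Q" for x y :: 'f
    using freshmans_dream'[where 'a = 'f, of Q e] p by simp
  then have diff: "(x - y) ^ Q = x ^ Q - y ^ Q" for x y :: 'f
    using add[of "x - y" y] by simp
  show ?thesis
    by unfold_locales
      (auto simp: fixed_field_def diff power_mult_distrib power_inverse algebra_simps)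
qed

text \<open>All n elements of K are roots of X^n - X, which has at most n roots. So a subfield is
  determined by its order.\<close>

lemma subfield_eq_fixed_field:
  assumes "subfield_space ((*) :: 'f::{field,finite} \<Rightarrow> 'f \<Rightarrow> 'f) K"
  shows "K = fixed_field (card K)"
proof -
  interpret K: subfield_space "(*) :: 'f \<Rightarrow> 'f \<Rightarrow> 'f" K by (rule assms)
  have "K \<subseteq> fixed_field (card K)"
    using K.power_card_eq by (auto simp: fixed_field_def)
  then show ?thesis
    using card_fixed_field_le[OF K.card_field_gt_1, where 'f = 'f] by (intro card_seteq) auto
qed

subsection \<open>Orbits of the multiplicative group\<close>

text \<open>For U containing 0 the scalar 0 belongs to it as well. This makes it a field when U is a
  subspace; the stabilizer in the multiplicative group consists of its nonzero elements.\<close>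

definition stabilizer :: "'f::field set \<Rightarrow> 'f set" where
  "stabilizer U = {c. \<forall>x\<in>U. c * x \<in> U}"

definition mult_orbit :: "'f::field set \<Rightarrow> 'f set set" where
  "mult_orbit U = {(*) c ` U | c. c \<noteq> 0}"

lemma image_mult_eq_iff:
  fixes U :: "'f::{field,finite} set"
  assumes "c \<noteq> 0" "d \<noteq> 0"
  shows "(*) c ` U = (*) d ` U \<longleftrightarrow> c / d \<in> stabilizer U"
proof
  assume e: "(*) c ` U = (*) d ` U"
  show "c / d \<in> stabilizer U"
    unfolding stabilizer_def
  proof (rule CollectI, rule ballI)
    fix x assume "x \<in> U"
    then have "c * x \<in> (*) d ` U" using e by blast
    then obtain y where "y \<in> U" "c * x = d * y" by blast
    then show "c / d * x \<in> U" using assms by (simp add: field_simps)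
  qed
next
  assume s: "c / d \<in> stabilizer U"
  have "c * x \<in> (*) d ` U" if "x \<in> U" for x
  proof -
    have "c / d * x \<in> U" using s that by (simp add: stabilizer_def)
    moreover have "c * x = d * (c / d * x)" using assms by simp
    ultimately show ?thesis by blast
  qed
  then have "(*) c ` U \<subseteq> (*) d ` U" by blast
  then show "(*) c ` U = (*) d ` U"
    using assms by (intro card_subset_eq) (auto simp: card_image inj_on_def)
qed

text \<open>Orbit-stabilizer: the fibres of the map from nonzero c to c U are cosets of the nonzero
  part of the stabilizer. The subtracted ones discard the scalar 0.\<close>

lemma card_mult_orbit:
  fixes U :: "'f::{field,finite} set"
  assumes "0 \<in> U"
  shows "card (mult_orbit U) * (card (stabilizer U) - 1) = CARD('f) - 1"
proof -
  let ?f = "\<lambda>c. (*) c ` U"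
  have fib: "card {c \<in> UNIV - {0}. ?f c = W} = card (stabilizer U) - 1" if "W \<in> mult_orbit U" for W
  proof -
    obtain d where d: "d \<noteq> 0" "W = ?f d" using \<open>W \<in> mult_orbit U\<close> by (auto simp: mult_orbit_def)
    have 1: "c \<in> (*) d ` (stabilizer U - {0})" if "c \<noteq> 0" "?f c = ?f d" for c
    proof -
      have "c / d \<in> stabilizer U - {0}" using image_mult_eq_iff[of c d U] that d by auto
      moreover have "c = d * (c / d)" using d by simp
      ultimately show ?thesis by blast
    qed
    have 2: "d * s \<noteq> 0 \<and> ?f (d * s) = ?f d" if "s \<in> stabilizer U - {0}" for s
      using image_mult_eq_iff[of "d * s" d U] that d by auto
    have "{c \<in> UNIV - {0}. ?f c = W} = (*) d ` (stabilizer U - {0})"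
    proof (intro equalityI subsetI)
      fix c assume "c \<in> {c \<in> UNIV - {0}. ?f c = W}"
      then show "c \<in> (*) d ` (stabilizer U - {0})" using 1[of c] d(2) by simp
    next
      fix c assume "c \<in> (*) d ` (stabilizer U - {0})"
      then obtain s where s: "s \<in> stabilizer U - {0}" "c = d * s" by blast
      show "c \<in> {c \<in> UNIV - {0}. ?f c = W}" using 2[OF s(1)] d(2) s(2) by simp
    qed
    moreover have "0 \<in> stabilizer U" using assms by (simp add: stabilizer_def)
    ultimately show ?thesis using d by (simp add: card_image inj_on_def card_Diff_subset)
  qed
  have "UNIV - {0} = (\<Union>W\<in>mult_orbit U. {c \<in> UNIV - {0}. ?f c = W})"
    by (auto simp: mult_orbit_def)
  also have "card \<dots> = (\<Sum>W\<in>mult_orbit U. card {c \<in> UNIV - {0}. ?f c = W})"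
    by (rule card_UN_disjoint) auto
  also have "\<dots> = (\<Sum>W\<in>mult_orbit U. card (stabilizer U) - 1)"
    by (rule sum.cong[OF refl fib])
  also have "\<dots> = card (mult_orbit U) * (card (stabilizer U) - 1)"
    by simp
  finally show ?thesis by (simp add: card_Diff_subset)
qed

lemma stabilizer_image_mult:
  assumes "(c :: 'f::field) \<noteq> 0"
  shows "stabilizer ((*) c ` U) = stabilizer U"
proof -
  have "d * (c * x) \<in> (*) c ` U \<longleftrightarrow> d * x \<in> U" for d x
  proof -
    have "d * (c * x) = c * (d * x)" by simp
    then show ?thesis using assms by (auto simp: image_iff)
  qed
  then show ?thesis unfolding stabilizer_def by simp
qed

lemma mult_orbit_self: "U \<in> mult_orbit U"
  by (auto simp: mult_orbit_def intro!: exI[of _ 1])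

lemma mult_orbit_eq:
  assumes "W \<in> mult_orbit (U :: 'f::field set)"
  shows "mult_orbit W = mult_orbit U"
proof -
  obtain c where c: "c \<noteq> 0" "W = (*) c ` U" using assms by (auto simp: mult_orbit_def)
  have W: "(*) d ` W = (*) (d * c) ` U" for d
    by (auto simp: c(2) image_image mult.assoc)
  have "(*) d ` U = (*) (d / c) ` W" for d
    unfolding W using c by simp
  then show ?thesis
    unfolding mult_orbit_def using c W by (metis divide_eq_0_iff no_zero_divisors)
qed

locale field_extension = subfield_space "(*)" E for E :: "'f::{field,finite} set" +
  fixes q l :: nat
  assumes card_E: "card E = q" and primepow_q: "primepow q"
    and card_F: "CARD('f) = q ^ l" and l_pos: "0 < l"
begin

declare scale_scale [simp del]

lemma q_gt_1: "q > 1"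
  using card_field_gt_1 card_E by simp

lemma power_q_eq_iff: "q ^ a = q ^ b \<longleftrightarrow> a = b"
  using q_gt_1 by (simp add: power_inject_exp)

text \<open>As a space over K, the set S has \<open>card K ^ a\<close> elements for some a;
  comparing exponents of q gives n = s a.\<close>

lemma subfield_card_dvd:
  assumes K: "subfield_space (*) K" "card K = q ^ s"
    and S: "subfield_space.E_subspace (*) K S" "card S = q ^ n"
  shows "s dvd n"
proof -
  interpret K: subfield_space "(*)" K by (rule K)
  obtain a where "card S = card K ^ a" using K.card_E_subspace[OF S(1)] by blast
  then have "q ^ n = q ^ (s * a)" using K S by (simp add: power_mult)
  then show ?thesis by (simp add: power_q_eq_iff)
qed

text \<open>Closure under inverses comes from finiteness: for c nonzero, c U lies in U and has the
  same size, so c U = U.\<close>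

lemma subfield_stabilizer:
  assumes U: "E_subspace U"
  shows "subfield_space (*) (stabilizer U)"
proof -
  have inv: "inverse c \<in> stabilizer U" if c: "c \<in> stabilizer U" for c
  proof (cases "c = 0")
    case False
    have "(*) c ` U \<subseteq> U" using c by (auto simp: stabilizer_def)
    then have e: "(*) c ` U = U"
      using False by (intro card_subset_eq) (auto simp: card_image inj_on_def)
    have "inverse c * x \<in> U" if "x \<in> U" for x
    proof -
      have "x \<in> (*) c ` U" using that e by simp
      then obtain y where "y \<in> U" "x = c * y" by blast
      then show ?thesis using False by (simp flip: mult.assoc)
    qed
    then show ?thesis by (simp add: stabilizer_def)
  qed (use c in simp)
  show ?thesis
    using E_subspace_diff[OF U] inv
    by unfold_locales (auto simp: stabilizer_def algebra_simps)
qed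

lemma E_subset_stabilizer: "E_subspace U \<Longrightarrow> E \<subseteq> stabilizer U"
  by (auto simp: stabilizer_def E_subspace_def)

lemma stabilizer_E_subspace:
  assumes U: "E_subspace U"
  shows "subfield_space.E_subspace (*) (stabilizer U) U"
proof -
  interpret K: subfield_space "(*)" "stabilizer U" by (rule subfield_stabilizer[OF U])
  show ?thesis using U unfolding K.E_subspace_def by (auto simp: E_subspace_def stabilizer_def)
qed

text \<open>Both U and the whole field are spaces over the stabilizer, so the degree of the
  stabilizer over \<open>E\<close> divides d and l.\<close>

lemma card_stabilizer:
  assumes U: "E_subspace U" "card U = q ^ d"
  shows "\<exists>s. s dvd gcd d l \<and> card (stabilizer U) = q ^ s"
proof -
  interpret K: subfield_space "(*)" "stabilizer U" by (rule subfield_stabilizer[OF U(1)])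
  have "E_subspace (stabilizer U)"
    using E_subset_stabilizer[OF U(1)] K.zero_mem K.add_mem K.mult_mem
    by (auto simp: E_subspace_def)
  then obtain s where s: "card (stabilizer U) = q ^ s"
    using card_E_subspace card_E by blast
  have "s dvd d"
    using subfield_card_dvd[OF K.subfield_space_axioms s stabilizer_E_subspace[OF U(1)] U(2)] .
  moreover have "s dvd l"
    using subfield_card_dvd[OF K.subfield_space_axioms s K.E_subspace_UNIV card_F] .
  ultimately show ?thesis using s by auto
qed

lemma
  assumes "t dvd l"
  shows fixed_field_subfield: "subfield_space (*) (fixed_field (q ^ t) :: 'f set)"
    and card_fixed_field_q: "card (fixed_field (q ^ t) :: 'f set) = q ^ t"
    and E_subset_fixed_field: "E \<subseteq> fixed_field (q ^ t)"
proof -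
  have t: "t > 0" using assms l_pos by (auto intro: Nat.gr0I)
  have F: "CARD('f) = (q ^ t) ^ (l div t)" using assms card_F by (simp flip: power_mult)
  have lt: "l div t > 0" using assms l_pos t by (auto elim: dvdE)
  have "primepow (q ^ t)" using primepow_q t primepow_power_iff_nat[of q t] primepow_gt_0_nat by blast
  then show "subfield_space (*) (fixed_field (q ^ t) :: 'f set)"
    using F lt by (rule subfield_fixed_field)
  show "card (fixed_field (q ^ t) :: 'f set) = q ^ t"
    using one_less_power[OF q_gt_1 t] F lt by (rule card_fixed_field)
  have "E = fixed_field q"
    using subfield_eq_fixed_field[OF subfield_space_axioms] card_E by simp
  then show "E \<subseteq> fixed_field (q ^ t)"
    by (auto simp: fixed_field_def power_pow_fixed)
qed

text \<open>The stabilizer is the fixed field for q^s, and the subfields of orders q^t and q^s are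
  nested exactly if t divides s. Containment of fields thus becomes the divisibility that Moebius
  inversion works with.\<close>

lemma fixed_field_subset_stabilizer_iff:
  assumes t: "t dvd l" and U: "E_subspace U" and s: "card (stabilizer U) = q ^ s"
  shows "fixed_field (q ^ t) \<subseteq> stabilizer U \<longleftrightarrow> t dvd s"
proof
  interpret K: subfield_space "(*)" "stabilizer U" by (rule subfield_stabilizer[OF U])
  interpret T: subfield_space "(*)" "fixed_field (q ^ t) :: 'f set"
    by (rule fixed_field_subfield[OF t])
  {
    assume "fixed_field (q ^ t) \<subseteq> stabilizer U"
    then have "T.E_subspace (stabilizer U)"
      using K.zero_mem K.add_mem K.mult_mem by (auto simp: T.E_subspace_def)
    then show "t dvd s"
      using subfield_card_dvd[OF T.subfield_space_axioms card_fixed_field_q[OF t]] s by blast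
  next
    assume "t dvd s"
    then have "q ^ s = (q ^ t) ^ (s div t)" by (simp flip: power_mult)
    moreover have "stabilizer U = fixed_field (q ^ s)"
      using subfield_eq_fixed_field[OF K.subfield_space_axioms] s by simp
    ultimately show "fixed_field (q ^ t) \<subseteq> stabilizer U"
      by (auto simp: fixed_field_def intro: power_pow_fixed)
  }
qed

section \<open>Counting subspaces and orbits by their stabilizer\<close>

definition spaces_with_stabilizer :: "nat \<Rightarrow> nat \<Rightarrow> 'f set set" where
  "spaces_with_stabilizer d u =
     {U. E_subspace U \<and> card U = q ^ d \<and> card (stabilizer U) = q ^ u}"

text \<open>Invariance makes U a space over the field with q^t elements, of dimension d/t inside a
  space of dimension l/t.\<close>

lemma card_invariant_subspaces:
  assumes d: "d \<le> l" and t: "t dvd gcd d l"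
  shows "real (card {U. E_subspace U \<and> card U = q ^ d \<and> fixed_field (q ^ t) \<subseteq> stabilizer U}) =
    gauss_binomial (q ^ t) (l div t) (d div t)"
proof -
  have tl: "t dvd l" and td: "t dvd d" using t by auto
  have t0: "t > 0" using tl l_pos by (auto intro: Nat.gr0I)
  interpret T: subfield_space "(*)" "fixed_field (q ^ t) :: 'f set"
    by (rule fixed_field_subfield[OF tl])
  let ?Q = "q ^ t" and ?b = "d div t"
  have Q: "?Q > 1" using one_less_power[OF q_gt_1 t0] .
  have cQ: "card (fixed_field ?Q :: 'f set) = ?Q" by (rule card_fixed_field_q[OF tl])
  have pd: "?Q ^ ?b = q ^ d" "?Q ^ (l div t) = CARD('f)"
    using td tl card_F by (simp_all flip: power_mult)
  have "E_subspace U \<and> fixed_field ?Q \<subseteq> stabilizer U \<longleftrightarrow> T.E_subspace U" for U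
    using E_subset_fixed_field[OF tl]
    by (auto simp: E_subspace_def T.E_subspace_def stabilizer_def)
  then have "{U. E_subspace U \<and> card U = q ^ d \<and> fixed_field ?Q \<subseteq> stabilizer U} =
      {U. T.E_subspace U \<and> U \<subseteq> UNIV \<and> card U = card (fixed_field ?Q :: 'f set) ^ ?b}"
    unfolding cQ pd by auto
  then have "card {U. E_subspace U \<and> card U = q ^ d \<and> fixed_field ?Q \<subseteq> stabilizer U} *
      (\<Prod>i<?b. ?Q ^ ?b - ?Q ^ i) = (\<Prod>i<?b. ?Q ^ (l div t) - ?Q ^ i)"
    using T.card_E_subspaces[OF T.E_subspace_UNIV, of ?b] unfolding cQ pd(2) by simp
  then have "real (card {U. E_subspace U \<and> card U = q ^ d \<and> fixed_field ?Q \<subseteq> stabilizer U}) *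
      qfall ?Q ?b ?b = qfall ?Q (l div t) ?b"
    unfolding of_nat_qfall[OF Q, symmetric] of_nat_mult[symmetric] by (rule arg_cong)
  moreover have "?b \<le> l div t" using d by (rule div_le_mono)
  ultimately show ?thesis
    unfolding gauss_binomial_eq_qfall[OF Q \<open>?b \<le> l div t\<close>]
    using qfall_diag_nonzero[OF Q, of ?b ?b] by (simp add: eq_divide_eq)
qed

text \<open>The spaces invariant under the subfield of order q^t are sorted by their exact
  stabilizer, of order q^s with t dividing s; this sum is then inverted.\<close>

lemma card_spaces_with_stabilizer:
  assumes d: "d \<le> l" and u: "u dvd gcd d l"
  shows "real (card (spaces_with_stabilizer d u)) =
    (\<Sum>t | u dvd t \<and> t dvd gcd d l.
       of_int (moebius (t div u)) * gauss_binomial (q ^ t) (l div t) (d div t))"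
proof -
  let ?g = "gcd d l"
  have g: "?g > 0" using l_pos by simp
  have N: "gauss_binomial (q ^ t) (l div t) (d div t) =
      (\<Sum>s | t dvd s \<and> s dvd ?g. real (card (spaces_with_stabilizer d s)))" if t: "t dvd ?g" for t
  proof -
    have tl: "t dvd l" using t by simp
    have "{U. E_subspace U \<and> card U = q ^ d \<and> fixed_field (q ^ t) \<subseteq> stabilizer U} =
        (\<Union>s\<in>{s. t dvd s \<and> s dvd ?g}. spaces_with_stabilizer d s)" (is "?L = ?R")
    proof (intro equalityI subsetI)
      fix U assume U: "U \<in> ?L"
      then obtain s where "s dvd ?g" "card (stabilizer U) = q ^ s"
        using card_stabilizer by blast
      then show "U \<in> ?R"
        using U fixed_field_subset_stabilizer_iff[OF tl, of U s]
        by (auto simp: spaces_with_stabilizer_def)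
    next
      fix U assume "U \<in> ?R"
      then show "U \<in> ?L"
        using fixed_field_subset_stabilizer_iff[OF tl, of U]
        by (auto simp: spaces_with_stabilizer_def)
    qed
    moreover have "card ?R = (\<Sum>s | t dvd s \<and> s dvd ?g. card (spaces_with_stabilizer d s))"
    proof (rule card_UN_disjoint)
      show "finite {s. t dvd s \<and> s dvd ?g}"
        by (rule finite_subset[of _ "{s. s dvd ?g}"]) (use g in auto)
    qed (auto simp: spaces_with_stabilizer_def power_q_eq_iff)
    ultimately show ?thesis
      using card_invariant_subspaces[OF d t] by simp
  qed
  have "(\<Sum>t | u dvd t \<and> t dvd ?g.
       of_int (moebius (t div u)) * gauss_binomial (q ^ t) (l div t) (d div t)) =
     (\<Sum>t | u dvd t \<and> t dvd ?g. of_int (moebius (t div u)) *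
       (\<Sum>s | t dvd s \<and> s dvd ?g. real (card (spaces_with_stabilizer d s))))"
    by (intro sum.cong refl) (simp add: N)
  also have "\<dots> = real (card (spaces_with_stabilizer d u))"
    by (rule moebius_inversion[OF g u])
  finally show ?thesis ..
qed

lemma spaces_with_stabilizer_orbit:
  assumes U: "U \<in> spaces_with_stabilizer d u" and W: "W \<in> mult_orbit U"
  shows "W \<in> spaces_with_stabilizer d u"
proof -
  obtain c where c: "c \<noteq> 0" "W = (*) c ` U" using W by (auto simp: mult_orbit_def)
  have "E_subspace W"
    unfolding E_subspace_def c(2)
  proof (intro conjI ballI)
    show "0 \<in> (*) c ` U" using U by (auto simp: spaces_with_stabilizer_def E_subspace_def)
  next
    fix x y assume "x \<in> (*) c ` U" "y \<in> (*) c ` U"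
    then obtain a b where "a \<in> U" "b \<in> U" "x = c * a" "y = c * b" by blast
    then show "x + y \<in> (*) c ` U"
      using U by (intro image_eqI[of _ _ "a + b"])
        (auto simp: spaces_with_stabilizer_def E_subspace_def algebra_simps)
  next
    fix e x assume "e \<in> E" "x \<in> (*) c ` U"
    then obtain a where "a \<in> U" "x = c * a" by blast
    then show "e * x \<in> (*) c ` U"
      using U \<open>e \<in> E\<close> by (intro image_eqI[of _ _ "e * a"])
        (auto simp: spaces_with_stabilizer_def E_subspace_def algebra_simps)
  qed
  moreover have "card W = card U" using c by (simp add: card_image inj_on_def)
  ultimately show ?thesis
    using U c by (simp add: spaces_with_stabilizer_def stabilizer_image_mult)
qed

lemma mult_orbit_disjoint:
  assumes "P \<in> mult_orbit ` X" "P' \<in> mult_orbit ` X" "P \<noteq> P'"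
  shows "P \<inter> P' = {}"
proof (rule ccontr)
  assume "P \<inter> P' \<noteq> {}"
  then obtain W where "W \<in> P" "W \<in> P'" by blast
  then have "mult_orbit W = P" "mult_orbit W = P'"
    using assms mult_orbit_eq by blast+
  then show False using assms by simp
qed

lemma card_orbit_real:
  assumes "U \<in> spaces_with_stabilizer d u" "u > 0"
  shows "real (card (mult_orbit U)) = (real q ^ l - 1) / (real q ^ u - 1)"
proof -
  have "0 \<in> U" using assms by (simp add: spaces_with_stabilizer_def E_subspace_def)
  then have "real (card (mult_orbit U) * (q ^ u - 1)) = real (q ^ l - 1)"
    using card_mult_orbit[of U] assms card_F by (simp add: spaces_with_stabilizer_def)
  moreover have "q ^ u > 1" using one_less_power[OF q_gt_1 assms(2)] .
  moreover have "real q ^ u > 1" using \<open>q ^ u > 1\<close> by (metis of_nat_1 of_nat_less_iff of_nat_power)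
  moreover have "q ^ l > 1" using one_less_power[OF q_gt_1 l_pos] .
  ultimately show ?thesis by (simp add: of_nat_diff eq_divide_eq)
qed

text \<open>Orbits with stabilizer of order q^u all have (q^l - 1)/(q^u - 1) members; dividing by
  this gives the prefactor in \<open>orbit_number\<close>.\<close>

lemma card_orbits:
  assumes d: "d \<le> l" and u: "u dvd gcd d l"
  shows "real (card (mult_orbit ` spaces_with_stabilizer d u)) = orbit_number q l d u"
proof -
  let ?X = "spaces_with_stabilizer d u" and ?c = "(real q ^ l - 1) / (real q ^ u - 1)"
  have u0: "u > 0" using u l_pos by (auto intro: Nat.gr0I)
  have "?X = \<Union>(mult_orbit ` ?X)"
    using mult_orbit_self spaces_with_stabilizer_orbit by blast
  then have "real (card ?X) = (\<Sum>P\<in>mult_orbit ` ?X. real (card P))"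
    using card_Union_disjoint[of "mult_orbit ` ?X"] mult_orbit_disjoint[of _ ?X]
    by (simp add: pairwise_def disjnt_def)
  also have "\<dots> = (\<Sum>P\<in>mult_orbit ` ?X. ?c)"
    by (intro sum.cong refl) (auto simp: card_orbit_real u0)
  also have "\<dots> = real (card (mult_orbit ` ?X)) * ?c" by simp
  finally have "real (card ?X) = real (card (mult_orbit ` ?X)) * ?c" .
  moreover have "real q ^ u > 1" "real q ^ l > 1"
    using q_gt_1 u0 l_pos by (simp_all add: one_less_power)
  ultimately show ?thesis
    unfolding orbit_number_def card_spaces_with_stabilizer[OF assms, symmetric]
    by (simp add: field_simps)
qed

text \<open>For each pair (r, u), any \<open>wr r u\<close> orbits are chosen, and \<open>C\<close>
  is the union of all of them. The weight f is left open; it will be the number of k-tuples that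
  span a space of the given dimension. An orbit counts with its size, which brings in q^u -
  1.\<close>

lemma ex_orbit_selection:
  fixes wr :: "nat \<Rightarrow> nat \<Rightarrow> int" and f :: "nat \<Rightarrow> real"
  assumes k: "k \<le> l"
    and wr: "\<And>r u. 2 \<le> r \<Longrightarrow> r \<le> k - 1 \<Longrightarrow> u dvd gcd (r + 1) l \<Longrightarrow>
      0 \<le> wr r u \<and> of_int (wr r u) \<le> orbit_number q l (r + 1) u"
  shows "\<exists>C \<delta>. (\<forall>U\<in>C. E_subspace U \<and> card U = q ^ \<delta> U \<and> 3 \<le> \<delta> U \<and> (\<forall>c. c \<noteq> 0 \<longrightarrow> (*) c ` U \<in> C)) \<and>
    (\<Sum>U\<in>C. f (\<delta> U)) = (\<Sum>r = 2..k - 1. \<Sum>u | u dvd gcd (r + 1) l.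
       of_int (wr r u) * ((real q ^ l - 1) / (real q ^ u - 1)) * f (r + 1))"
proof -
  let ?I = "SIGMA r : {2..k - 1}. {u. u dvd gcd (r + 1) l}"
  let ?X = "\<lambda>(r, u). spaces_with_stabilizer (r + 1) u"
  have finI: "finite ?I" by (intro finite_SigmaI) auto
  have u0: "u > 0" if "(r, u) \<in> ?I" for r u using that by (auto intro: Nat.gr0I)
  have "\<forall>p\<in>?I. \<exists>S. S \<subseteq> mult_orbit ` ?X p \<and> int (card S) = wr (fst p) (snd p)"
  proof
    fix p assume p: "p \<in> ?I"
    obtain r u where ru: "p = (r, u)" by fastforce
    then have r: "2 \<le> r" "r \<le> k - 1" "u dvd gcd (r + 1) l" "r + 1 \<le> l" using p k by auto
    have "real (nat (wr r u)) \<le> real (card (mult_orbit ` ?X p))"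
      using wr[OF r(1,2,3)] card_orbits[OF r(4,3)] ru by simp
    then have "nat (wr r u) \<le> card (mult_orbit ` ?X p)" by simp
    then obtain S where "S \<subseteq> mult_orbit ` ?X p" "card S = nat (wr r u)"
      by (rule obtain_subset_with_card_n)
    then show "\<exists>S. S \<subseteq> mult_orbit ` ?X p \<and> int (card S) = wr (fst p) (snd p)"
      using wr[OF r(1,2,3)] ru by auto
  qed
  then obtain S where S: "\<And>p. p \<in> ?I \<Longrightarrow> S p \<subseteq> mult_orbit ` ?X p"
      "\<And>p. p \<in> ?I \<Longrightarrow> int (card (S p)) = wr (fst p) (snd p)"
    by metis
  define C where "C = (\<Union>p\<in>?I. \<Union>(S p))"
  \<comment> \<open>The dimension is recovered from the cardinality, as q > 1 makes the exponent
    unique.\<close>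
  define \<delta> where "\<delta> U = (THE n. card U = q ^ n)" for U :: "'f set"
  have \<delta>: "\<delta> U = n" if "card U = q ^ n" for U n
    unfolding \<delta>_def using that by (auto simp: power_q_eq_iff)
  have SX: "U \<in> ?X p" if "p \<in> ?I" "U \<in> \<Union>(S p)" for p U
  proof -
    obtain W where "W \<in> ?X p" "U \<in> mult_orbit W" using S(1) \<open>p \<in> ?I\<close> \<open>U \<in> \<Union>(S p)\<close> by blast
    then show ?thesis by (auto intro: spaces_with_stabilizer_orbit split: prod.splits)
  qed
  have CX: "\<exists>r u. (r, u) \<in> ?I \<and> U \<in> spaces_with_stabilizer (r + 1) u" if U: "U \<in> C" for U
  proof -
    obtain p where p: "p \<in> ?I" "U \<in> \<Union>(S p)" using U unfolding C_def by blast
    obtain r u where "p = (r, u)" by fastforce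
    then show ?thesis using SX[OF p] p(1) by auto
  qed
  show ?thesis
  proof (intro exI[of _ C] exI[of _ \<delta>] conjI ballI allI impI)
    fix U assume U: "U \<in> C"
    then obtain r u where ru: "(r, u) \<in> ?I" "U \<in> spaces_with_stabilizer (r + 1) u"
      using CX by blast
    then show "E_subspace U" "card U = q ^ \<delta> U" "3 \<le> \<delta> U"
      using \<delta>[of U "r + 1"] by (auto simp: spaces_with_stabilizer_def)
  next
    fix U and c :: 'f assume "U \<in> C" "c \<noteq> 0"
    then obtain p P where p: "p \<in> ?I" "P \<in> S p" "U \<in> P" unfolding C_def by blast
    then obtain W where "P = mult_orbit W" using S(1) by blast
    then have "P = mult_orbit U" using p mult_orbit_eq by blast
    then have "(*) c ` U \<in> P" using \<open>c \<noteq> 0\<close> by (auto simp: mult_orbit_def)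
    then show "(*) c ` U \<in> C" using p unfolding C_def by blast
  next
    have "(\<Sum>U\<in>C. f (\<delta> U)) = (\<Sum>p\<in>?I. \<Sum>U\<in>\<Union>(S p). f (\<delta> U))"
      unfolding C_def
    proof (rule sum.UNION_disjoint[OF finI])
      \<comment> \<open>The size of U fixes r and the size of its stabilizer fixes u, so different
        pairs contribute disjoint sets of spaces.\<close>
      show "\<forall>p\<in>?I. \<forall>p'\<in>?I. p \<noteq> p' \<longrightarrow> \<Union>(S p) \<inter> \<Union>(S p') = {}"
      proof (intro ballI impI, rule ccontr)
        fix p p' assume p: "p \<in> ?I" "p' \<in> ?I" "p \<noteq> p'" "\<Union>(S p) \<inter> \<Union>(S p') \<noteq> {}"
        then obtain U where U: "U \<in> \<Union>(S p)" "U \<in> \<Union>(S p')" by blast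
        have "U \<in> ?X p" "U \<in> ?X p'" using SX[OF p(1) U(1)] SX[OF p(2) U(2)] by simp_all
        then have "p = p'"
          using q_gt_1 by (auto simp: spaces_with_stabilizer_def power_q_eq_iff split: prod.splits)
        then show False using p by simp
      qed
    qed simp
    also have "\<dots> = (\<Sum>p\<in>?I. of_int (wr (fst p) (snd p)) *
        ((real q ^ l - 1) / (real q ^ snd p - 1)) * f (fst p + 1))"
    proof (rule sum.cong[OF refl])
      fix p assume p: "p \<in> ?I"
      obtain r u where ru: "p = (r, u)" by fastforce
      have "(\<Sum>U\<in>\<Union>(S p). f (\<delta> U)) = (\<Sum>U\<in>\<Union>(S p). f (r + 1))"
      proof (rule sum.cong[OF refl])
        fix U assume "U \<in> \<Union>(S p)"
        then have "U \<in> spaces_with_stabilizer (r + 1) u" using SX[OF p] ru by simp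
        then have "\<delta> U = r + 1" by (intro \<delta>) (simp add: spaces_with_stabilizer_def)
        then show "f (\<delta> U) = f (r + 1)" by simp
      qed
      also have "\<dots> = real (card (\<Union>(S p))) * f (r + 1)" by simp
      also have "card (\<Union>(S p)) = (\<Sum>P\<in>S p. card P)"
      proof (rule card_Union_disjoint)
        show "pairwise disjnt (S p)"
          using S(1)[OF p] mult_orbit_disjoint[of _ "?X p"]
          by (auto simp: pairwise_def disjnt_def subset_iff)
      qed simp
      also have "real \<dots> = (\<Sum>P\<in>S p. (real q ^ l - 1) / (real q ^ u - 1))"
        unfolding of_nat_sum
      proof (rule sum.cong[OF refl])
        fix P assume "P \<in> S p"
        then obtain U where "U \<in> spaces_with_stabilizer (r + 1) u" "P = mult_orbit U"
          using S(1)[OF p] ru by auto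
        then show "real (card P) = (real q ^ l - 1) / (real q ^ u - 1)"
          using card_orbit_real u0 p ru by blast
      qed
      also have "\<dots> = of_int (int (card (S p))) * ((real q ^ l - 1) / (real q ^ u - 1))" by simp
      finally show "(\<Sum>U\<in>\<Union>(S p). f (\<delta> U)) = of_int (wr (fst p) (snd p)) *
          ((real q ^ l - 1) / (real q ^ snd p - 1)) * f (fst p + 1)"
        using S(2)[OF p] ru by simp
    qed
    also have "\<dots> = (\<Sum>r = 2..k - 1. \<Sum>u | u dvd gcd (r + 1) l.
       of_int (wr r u) * ((real q ^ l - 1) / (real q ^ u - 1)) * f (r + 1))"
      by (subst sum.Sigma) (auto intro!: sum.cong)
    finally show "(\<Sum>U\<in>C. f (\<delta> U)) = (\<Sum>r = 2..k - 1. \<Sum>u | u dvd gcd (r + 1) l.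
       of_int (wr r u) * ((real q ^ l - 1) / (real q ^ u - 1)) * f (r + 1))" .
  qed
qed

end

subsection \<open>The Desarguesian spread\<close>

lemma sum_upto_choose: "2 \<le> k \<Longrightarrow> \<Sum>{2..<k} = (k choose 2) - 1"
proof (induction k rule: dec_induct)
  case (step n)
  have "n choose 2 > 0" using step by simp
  moreover have "Suc n choose 2 = n + (n choose 2)"
    using binomial_Suc_Suc[of n 1] by (simp add: numeral_2_eq_2)
  moreover have "\<Sum>{2..<Suc n} = ((n choose 2) - 1) + n" using step by simp
  ultimately show ?case by linarith
qed simp

text \<open>Pulling q^(jl) out of each numerator factor and q^j out of each denominator factor
  leaves q^((l-1)j). The values j = 2, ..., k-1 add up to \<open>(k choose 2) - 1\<close>, and
  \<open>k \<le> m + 1\<close> ensures j <= m.\<close>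

lemma prod_independent_quotient:
  assumes q: "q > 1" and l: "l > 0" and k: "2 \<le> k" "k \<le> m + 1"
  shows "(\<Prod>j=2..<k. real (q ^ l) ^ m - real (q ^ l) ^ j) / (\<Prod>j=2..<k. real q ^ k - real q ^ j) =
    real q ^ ((l - 1) * ((k choose 2) - 1)) *
      (\<Prod>j = 2..k - 1. (real q ^ ((m - j) * l) - 1) / (real q ^ (k - j) - 1))"
proof -
  have "(\<Prod>j=2..<k. real (q ^ l) ^ m - real (q ^ l) ^ j) / (\<Prod>j=2..<k. real q ^ k - real q ^ j) =
      (\<Prod>j=2..<k. real q ^ ((l - 1) * j) * ((real q ^ ((m - j) * l) - 1) / (real q ^ (k - j) - 1)))"
    unfolding prod_dividef[symmetric]
  proof (rule prod.cong[OF refl])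
    fix j assume j: "j \<in> {2..<k}"
    have "real (q ^ l) ^ m = real q ^ (j * l) * real q ^ ((m - j) * l)"
    proof -
      have "l * m = j * l + (m - j) * l"
      proof -
        have "j \<le> m" using j k by auto
        then show ?thesis by (simp add: mult.commute[of l] flip: add_mult_distrib)
      qed
      then show ?thesis by (simp flip: power_mult power_add)
    qed
    then have 1: "real (q ^ l) ^ m - real (q ^ l) ^ j = real q ^ (j * l) * (real q ^ ((m - j) * l) - 1)"
      by (simp add: algebra_simps flip: power_mult)
    have "real q ^ k = real q ^ j * real q ^ (k - j)"
      using j by (simp flip: power_add)
    then have 2: "real q ^ k - real q ^ j = real q ^ j * (real q ^ (k - j) - 1)"
      by (simp add: algebra_simps)
    have "j * l = j + (l - 1) * j"
      using l by (cases l) simp_all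
    then have 3: "real q ^ (j * l) = real q ^ j * real q ^ ((l - 1) * j)"
      by (simp add: power_add)
    show "(real (q ^ l) ^ m - real (q ^ l) ^ j) / (real q ^ k - real q ^ j) =
        real q ^ ((l - 1) * j) * ((real q ^ ((m - j) * l) - 1) / (real q ^ (k - j) - 1))"
      unfolding 1 2 3 using q by simp
  qed
  also have "\<dots> = (\<Prod>j=2..<k. real q ^ ((l - 1) * j)) *
      (\<Prod>j=2..<k. (real q ^ ((m - j) * l) - 1) / (real q ^ (k - j) - 1))"
    by (rule prod.distrib)
  also have "(\<Prod>j=2..<k. real q ^ ((l - 1) * j)) = real q ^ ((l - 1) * ((k choose 2) - 1))"
    using sum_upto_choose[OF k(1)] by (simp flip: power_sum sum_distrib_left)
  finally show ?thesis
    using k by (simp only: atLeastLessThanSuc_atLeastAtMost[symmetric]) (simp add: Suc_diff_le)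
qed

text \<open>The factors with j from 2 to r cancel; those with j = 0, 1 survive above, those from r +
  1 on below.\<close>

lemma qfall_quotient:
  assumes q: "q > 1" and r: "2 \<le> r" "r < k"
  shows "qfall q k (r + 1) / (\<Prod>j=2..<k. real q ^ k - real q ^ j) =
    (real q ^ k - 1) * (real q ^ k - real q) / (\<Prod>j=r + 1..k - 1. real q ^ k - real q ^ j)"
proof -
  let ?f = "\<lambda>j. real q ^ k - real q ^ j"
  have "{..<r + 1} = {0, 1} \<union> {2..<r + 1}" using r by auto
  then have "qfall q k (r + 1) = (\<Prod>j\<in>{0, 1}. ?f j) * (\<Prod>j=2..<r + 1. ?f j)"
    unfolding qfall_def by (simp only:) (rule prod.union_disjoint, auto)
  then have 1: "qfall q k (r + 1) = (real q ^ k - 1) * (real q ^ k - real q) * (\<Prod>j=2..<r + 1. ?f j)"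
    by simp
  have "{2..<k} = {2..<r + 1} \<union> {r + 1..k - 1}" using r by auto
  then have 2: "(\<Prod>j=2..<k. ?f j) = (\<Prod>j=2..<r + 1. ?f j) * (\<Prod>j=r + 1..k - 1. ?f j)"
    by (simp only:) (rule prod.union_disjoint, auto)
  have "a * c / (c * b) = a / b" if "c \<noteq> 0" for a b c :: real
    using that by simp
  moreover have "(\<Prod>j=2..<r + 1. ?f j) \<noteq> 0" using q r by (auto simp: prod_zero_iff)
  ultimately show ?thesis unfolding 1 2 by blast
qed

section \<open>From dimensions to cardinalities\<close>

context gf_vector_space
begin

lemma card_subspace_eq: "subspace S \<Longrightarrow> card S = CARD('a) ^ dim S"
proof -
  assume S: "subspace S"
  obtain B where B: "B \<subseteq> S" "independent B" "S \<subseteq> span B" "card B = dim S"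
    using basis_exists by blast
  then have "span B = S" using S span_minimal by blast
  then show ?thesis using card_span_independent[of B] B finite[of B] by auto
qed

lemma card_scalars_gt_1: "CARD('a) > 1"
proof -
  have "card {0, 1 :: 'a} \<le> CARD('a)" by (intro card_mono) auto
  then show ?thesis by simp
qed

lemma dim_eq_iff_card: "subspace S \<Longrightarrow> dim S = i \<longleftrightarrow> card S = CARD('a) ^ i"
  using card_subspace_eq[of S] card_scalars_gt_1 by (simp add: power_inject_exp)

text \<open>The counting arguments measure subspaces by cardinality; this form connects them with
  the dimensions in the definition of a design.\<close>

lemma i_subspaces_eq: "i_subspaces i = {S. subspace S \<and> card S = CARD('a) ^ i}"
  using dim_eq_iff_card by (auto simp: i_subspaces_def)

lemma dim_le_iff_card: "subspace S \<Longrightarrow> dim S \<le> i \<longleftrightarrow> card S \<le> CARD('a) ^ i"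
  using card_subspace_eq[of S] card_scalars_gt_1 by (simp add: power_increasing_iff)

end

section \<open>Lines over the large field and the general linear group\<close>

lemma gf_vector_space_vec:
  "gf_vector_space ((*s) :: 'f::{field,finite} \<Rightarrow> 'f ^ 'm::finite \<Rightarrow> 'f ^ 'm)"
  by unfold_locales

lemma desarguesian_spread_iff:
  "W \<in> (desarguesian_spread :: ('f::{field,finite} ^ 'm::finite) set set) \<longleftrightarrow>
     vec.subspace W \<and> card W = CARD('f)"
proof -
  interpret gf_vector_space "(*s) :: 'f \<Rightarrow> 'f ^ 'm \<Rightarrow> 'f ^ 'm"
    by (rule gf_vector_space_vec)
  show ?thesis using dim_eq_iff_card[of W 1] by (auto simp: desarguesian_spread_def)
qed

lemma card_line:
  fixes v :: "'f::{field,finite} ^ 'm::finite"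
  assumes "v \<noteq> 0"
  shows "card ((\<lambda>c. c *s v) ` A) = card A"
  using assms by (intro card_image) (auto simp: inj_on_def vec.scale_right_imp_eq)

lemma line_mem_spread:
  fixes v :: "'f::{field,finite} ^ 'm::finite"
  assumes "v \<noteq> 0"
  shows "range (\<lambda>c. c *s v) \<in> desarguesian_spread"
proof -
  have "range (\<lambda>c. c *s v) = vec.span {v}" by (simp add: vec.span_singleton)
  then show ?thesis using card_line[OF assms, of UNIV] by (simp add: desarguesian_spread_iff)
qed

text \<open>The multiples of v form a subset of W of the same size. Hence groups that share a
  nonzero vector coincide.\<close>

lemma spread_eq_line:
  fixes v :: "'f::{field,finite} ^ 'm::finite"
  assumes W: "W \<in> desarguesian_spread" and v: "v \<in> W" "v \<noteq> 0"
  shows "W = range (\<lambda>c. c *s v)"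
proof -
  have "range (\<lambda>c. c *s v) \<subseteq> W"
    using W v by (auto simp: desarguesian_spread_iff intro: vec.subspace_scale)
  then show ?thesis
    using W card_line[OF v(2), of UNIV] by (intro card_subset_eq[symmetric]) (auto simp: desarguesian_spread_iff)
qed

lemma spread_ex_nonzero:
  fixes W :: "('f::{field,finite} ^ 'm::finite) set"
  assumes "W \<in> desarguesian_spread"
  obtains v where "v \<in> W" "v \<noteq> 0"
proof -
  have "card {0, 1 :: 'f} \<le> CARD('f)" by (intro card_mono) auto
  then have "\<not> W \<subseteq> {0}"
    using assms card_mono[of "{0}" W] by (auto simp: desarguesian_spread_iff)
  then show ?thesis using that by blast
qed

lemma GL_action_linear:
  assumes "f \<in> (GL_action :: ('f::field ^ 'm::finite \<Rightarrow> 'f ^ 'm) set)"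
  shows "bij f" "f (x + y) = f x + f y" "f (c *s x) = c *s f x"
proof -
  obtain A :: "'f ^ 'm ^ 'm" where A: "f = (*v) A" "invertible A"
    using assms by (auto simp: GL_action_def)
  then obtain B where B: "A ** B = mat 1" "B ** A = mat 1" by (auto simp: invertible_def)
  show "bij f"
    by (rule o_bij[of "(*v) B"]) (auto simp: A fun_eq_iff matrix_vector_mul_assoc B)
  show "f (x + y) = f x + f y" "f (c *s x) = c *s f x"
    by (simp_all add: A matrix_vector_right_distrib vector_scalar_commute)
qed

lemma GL_action_group:
  shows "id \<in> (GL_action :: ('f::field ^ 'm::finite \<Rightarrow> 'f ^ 'm) set)"
    and "f \<in> GL_action \<Longrightarrow> g \<in> GL_action \<Longrightarrow> f \<circ> g \<in> (GL_action :: ('f ^ 'm \<Rightarrow> 'f ^ 'm) set)"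
    and "f \<in> GL_action \<Longrightarrow> inv f \<in> (GL_action :: ('f ^ 'm \<Rightarrow> 'f ^ 'm) set)"
proof -
  have "id = (*v) (mat 1 :: 'f ^ 'm ^ 'm)" "invertible (mat 1 :: 'f ^ 'm ^ 'm)"
    by (auto simp: fun_eq_iff invertible_def intro!: exI[of _ "mat 1"])
  then show "id \<in> (GL_action :: ('f ^ 'm \<Rightarrow> 'f ^ 'm) set)"
    unfolding GL_action_def by blast
  show "f \<circ> g \<in> (GL_action :: ('f ^ 'm \<Rightarrow> 'f ^ 'm) set)" if fg: "f \<in> GL_action" "g \<in> GL_action"
  proof -
    obtain A B :: "'f ^ 'm ^ 'm" where "f = (*v) A" "invertible A" "g = (*v) B" "invertible B"
      using fg by (auto simp: GL_action_def)
    then have "f \<circ> g = (*v) (A ** B)" "invertible (A ** B)"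
      by (auto simp: fun_eq_iff matrix_vector_mul_assoc invertible_mult)
    then show ?thesis unfolding GL_action_def by blast
  qed
  show "inv f \<in> (GL_action :: ('f ^ 'm \<Rightarrow> 'f ^ 'm) set)" if f: "f \<in> GL_action"
  proof -
    obtain A :: "'f ^ 'm ^ 'm" where A: "f = (*v) A" "invertible A"
      using f by (auto simp: GL_action_def)
    then obtain B where B: "A ** B = mat 1" "B ** A = mat 1" by (auto simp: invertible_def)
    have "inv f = (*v) B"
      by (rule inv_unique_comp) (auto simp: A fun_eq_iff matrix_vector_mul_assoc B)
    moreover have "invertible B" using B by (auto simp: invertible_def)
    ultimately show ?thesis unfolding GL_action_def by blast
  qed
qed

text \<open>Lines go to lines, and an injection of the finite set of lines into itself is
  onto.\<close>

lemma GL_action_spread: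
  assumes f: "f \<in> (GL_action :: ('f::{field,finite} ^ 'm::finite \<Rightarrow> 'f ^ 'm) set)"
  shows "(`) f ` desarguesian_spread = desarguesian_spread"
proof (rule card_subset_eq)
  have f0: "f 0 = 0" using GL_action_linear(2)[OF f, of 0 0] by simp
  have inj: "inj f" using GL_action_linear(1)[OF f] bij_is_inj by blast
  show "(`) f ` desarguesian_spread \<subseteq> desarguesian_spread"
  proof clarify
    fix W :: "('f ^ 'm) set" assume W: "W \<in> desarguesian_spread"
    then obtain v where v: "v \<in> W" "v \<noteq> 0" by (rule spread_ex_nonzero)
    have "f ` W = range (\<lambda>c. c *s f v)"
      using GL_action_linear(3)[OF f] by (simp add: spread_eq_line[OF W v] image_image)
    moreover have "f v \<noteq> 0" using inj v f0 by (metis injD)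
    ultimately show "f ` W \<in> desarguesian_spread" by (simp add: line_mem_spread)
  qed
  show "card ((`) f ` desarguesian_spread) = card (desarguesian_spread :: ('f ^ 'm) set set)"
    using inj by (intro card_image) (auto simp: inj_on_def inj_image_eq_iff)
qed simp

section \<open>The embedding of the small field and its image\<close>

context
  fixes h :: "'q::field \<Rightarrow> 'f::field"
  assumes h: "field_embedding h"
begin

lemma field_embedding_simps:
  "h 1 = 1" "h (x + y) = h x + h y" "h (x * y) = h x * h y"
  using h by (auto simp: field_embedding_def)

lemma field_embedding_diff: "h (x - y) = h x - h y"
  using field_embedding_simps(2)[of "x - y" y] by simp

lemma field_embedding_mult_inverse: "x \<noteq> 0 \<Longrightarrow> h x * h (inverse x) = 1"
  using field_embedding_simps(1) by (simp flip: field_embedding_simps(3))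

lemma field_embedding_inj: "inj h"
proof (rule injI, rule ccontr)
  fix x y assume "h x = h y" "x \<noteq> y"
  then show False
    using field_embedding_mult_inverse[of "x - y"] field_embedding_diff[of x y] by simp
qed

lemma field_embedding_inverse: "h (inverse x) = inverse (h x)"
proof (cases "x = 0")
  case True
  have "h 0 = 0" using field_embedding_diff[of 0 0] by simp
  then show ?thesis using True by simp
next
  case False
  show ?thesis using inverse_unique[OF field_embedding_mult_inverse[OF False]] by simp
qed

end

lemma subfield_range:
  fixes h :: "'q::field \<Rightarrow> 'f::{field,finite}"
  assumes h: "field_embedding h"
  shows "subfield_space ((*) :: 'f \<Rightarrow> 'f \<Rightarrow> 'f) (range h)"
proof unfold_locales
  fix c d assume "c \<in> range h" "d \<in> range h"
  then obtain x y where "c = h x" "d = h y" by blast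
  then have "c - d = h (x - y)" "c * d = h (x * y)" "inverse c = h (inverse x)"
    by (simp_all add: field_embedding_diff[OF h] field_embedding_simps[OF h] field_embedding_inverse[OF h])
  then show "c - d \<in> range h" "c * d \<in> range h" "inverse c \<in> range h" by simp_all
next
  show "1 \<in> range h" using field_embedding_simps(1)[OF h] by (metis rangeI)
qed

section \<open>Construction and verification of the design\<close>

theorem theorem5p1:
  fixes q m l k :: nat
    and h :: "'q::{field,finite} \<Rightarrow> 'f::{field,finite}"
    and w :: int
    and wr :: "nat \<Rightarrow> nat \<Rightarrow> int"
  assumes "primepow q"
    and "CARD('q) = q" and "CARD('f) = q ^ l" and "CARD('m::finite) = m"
    and "field_embedding h"
    and "0 < m" and "0 < l" and "3 \<le> k" and "k \<le> min (m + 1) l"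
    and "w \<in> {0, 1}"
    and "\<And>r u. \<lbrakk>2 \<le> r; r \<le> k - 1; 0 < u; u dvd gcd (r + 1) l\<rbrakk> \<Longrightarrow>
           0 \<le> wr r u \<and> of_int (wr r u) \<le> orbit_number q l (r + 1) u"
  shows "\<exists>(\<B> :: ('f ^ 'm) set multiset) (lam :: nat).
     gf_vector_space.q_gdd (restricted_scale h) q (m * l) l k lam desarguesian_spread \<B> \<and>
     simple_blocks \<B> \<and>
     gf_vector_space.admits_automorphism_group (restricted_scale h) GL_action desarguesian_spread \<B> \<and>
     real lam =
       (\<Sum>r = 2..k - 1. \<Sum>u | u dvd gcd (r + 1) l.
          of_int (wr r u) *
          ((real q ^ k - 1) * (real q ^ k - real q) *
             (\<Prod>j = 2..k - 2. real q ^ (m * l) - real q ^ (j * l)) /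
           ((real q ^ u - 1) * (\<Prod>j = r + 1..k - 1. real q ^ k - real q ^ j)))) +
       of_int w * real q ^ ((l - 1) * ((k choose 2) - 1)) *
         (\<Prod>j = 2..k - 1. (real q ^ ((m - j) * l) - 1) / (real q ^ (k - j) - 1))"
proof -
  let ?E = "range h"
  interpret K: subfield_space "(*) :: 'f \<Rightarrow> 'f \<Rightarrow> 'f" ?E
    by (rule subfield_range[OF assms(5)])
  have cardE: "card ?E = q"
    using field_embedding_inj[OF assms(5)] assms(2) by (simp add: card_image)
  have km: "k \<le> m + 1" "k \<le> l" and k3: "3 \<le> k" using assms(8,9) by auto
  interpret X: field_extension ?E q l
    by unfold_locales (use cardE assms in auto)
  have q1: "q > 1" by (rule X.q_gt_1)
  have wr: "0 \<le> wr r u \<and> of_int (wr r u) \<le> orbit_number q l (r + 1) u"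
    if "2 \<le> r" "r \<le> k - 1" "u dvd gcd (r + 1) l" for r u
  proof -
    have "0 < u" using that(3) assms(7) by (auto intro: Nat.gr0I)
    then show ?thesis using that assms(11) by blast
  qed
  obtain C \<delta> where C: "\<And>U. U \<in> C \<Longrightarrow> K.E_subspace U"
      "\<And>U. U \<in> C \<Longrightarrow> card U = q ^ \<delta> U" "\<And>U. U \<in> C \<Longrightarrow> 3 \<le> \<delta> U"
      "\<And>U c. U \<in> C \<Longrightarrow> c \<noteq> 0 \<Longrightarrow> (*) c ` U \<in> C"
    and C_sum: "(\<Sum>U\<in>C. qfall q k (\<delta> U)) = (\<Sum>r = 2..k - 1. \<Sum>u | u dvd gcd (r + 1) l.
       of_int (wr r u) * ((real q ^ l - 1) / (real q ^ u - 1)) * qfall q k (r + 1))"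
  proof -
    have "\<exists>C \<delta>. (\<forall>U\<in>C. K.E_subspace U \<and> card U = q ^ \<delta> U \<and> 3 \<le> \<delta> U \<and>
        (\<forall>c. c \<noteq> 0 \<longrightarrow> (*) c ` U \<in> C)) \<and>
      (\<Sum>U\<in>C. qfall q k (\<delta> U)) = (\<Sum>r = 2..k - 1. \<Sum>u | u dvd gcd (r + 1) l.
        of_int (wr r u) * ((real q ^ l - 1) / (real q ^ u - 1)) * qfall q k (r + 1))"
      by (rule X.ex_orbit_selection[OF km(2)]) (rule wr)
    then show thesis using that by (elim exE conjE) blast
  qed
  \<comment> \<open>Dimensions r + 1 with r >= 2 give the cardinality bound with exponent 3; a union
    of whole orbits is closed under scaling.\<close>
  interpret V: relation_blocks "(*s) :: 'f \<Rightarrow> 'f ^ 'm \<Rightarrow> 'f ^ 'm" ?E k "w = 1" C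
  proof unfold_locales
    show "card ?E ^ 3 \<le> card U" if "U \<in> C" for U
      using C(2,3)[OF that] q1 cardE by (simp add: power_increasing)
  qed (use K.one_mem K.diff_mem K.mult_mem K.inverse_mem k3 C(1,4) in auto)
  interpret G: gf_vector_space "restricted_scale h :: 'q \<Rightarrow> 'f ^ 'm \<Rightarrow> 'f ^ 'm"
    by (rule gf_vector_space_restricted_scale[OF assms(5)])
  let ?S = "desarguesian_spread :: ('f ^ 'm) set set"
  have G_subspace: "G.subspace S \<longleftrightarrow> V.E_subspace S" for S
    by (auto simp: G.subspace_def V.E_subspace_def restricted_scale_def)
  have G_i: "G.i_subspaces i = {S. V.E_subspace S \<and> card S = q ^ i}" for i
    unfolding G.i_subspaces_eq G_subspace assms(2) ..
  have spread_E: "V.E_subspace W" if "W \<in> ?S" for W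
    using that by (auto simp: desarguesian_spread_iff V.E_subspace_def vec.subspace_def)
  have spread_disjoint: "W = W'" if "W \<in> ?S" "W' \<in> ?S" "v \<in> W" "v \<in> W'" "v \<noteq> 0" for W W' v
    using spread_eq_line[OF that(1,3,5)] spread_eq_line[OF that(2,4,5)] by simp
  have card_V: "CARD('f ^ 'm) = CARD('f) ^ m" using assms(4) by simp
  have m2: "2 \<le> m" using km k3 by simp

  have point_nonzero: "\<exists>v\<in>P. v \<noteq> 0" if P: "P \<in> G.i_subspaces 1" for P
  proof (rule ccontr)
    assume "\<not> ?thesis"
    then have "P \<subseteq> {0}" by blast
    then have "card P \<le> card {0 :: 'f ^ 'm}" by (rule card_mono[rotated]) simp
    then show False using P q1 by (simp add: G_i)
  qed
  have point: "(\<lambda>e. e *s v) ` ?E \<in> G.i_subspaces 1" if "v \<noteq> 0" for v :: "'f ^ 'm"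
  proof -
    \<comment> \<open>A one-element index set presents the point through v as the span of a
      family.\<close>
    have "(\<lambda>e. e *s v) ` ?E = V.span_of {()} (\<lambda>_. v)"
      by (auto simp: V.span_of_def V.comb_def)
    then have "V.E_subspace ((\<lambda>e. e *s v) ` ?E)" by (simp add: V.E_subspace_span_of)
    then show ?thesis using card_line[OF that, of ?E] cardE by (simp add: G_i)
  qed
  have point_eq: "P = (\<lambda>e. e *s v) ` ?E" if P: "P \<in> G.i_subspaces 1" "v \<in> P" "v \<noteq> 0" for P v
  proof -
    have "(\<lambda>e. e *s v) ` ?E \<subseteq> P"
      using P by (auto simp: G_i intro: V.E_subspace_scale)
    then show ?thesis
      using P card_line[OF P(3), of ?E] cardE
      by (intro card_subset_eq[symmetric]) (auto simp: G_i)
  qed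
  have partition: "partition_on (G.i_subspaces 1) ((\<lambda>W. {P \<in> G.i_subspaces 1. P \<subseteq> W}) ` ?S)"
    unfolding partition_on_def
  proof (intro conjI)
    show "\<Union>((\<lambda>W. {P \<in> G.i_subspaces 1. P \<subseteq> W}) ` ?S) = G.i_subspaces 1"
    proof (intro equalityI subsetI)
      fix P assume P: "P \<in> G.i_subspaces 1"
      then obtain v where v: "v \<in> P" "v \<noteq> 0" using point_nonzero by blast
      have "P \<subseteq> range (\<lambda>c. c *s v)" using point_eq[OF P v] by auto
      then show "P \<in> \<Union>((\<lambda>W. {P \<in> G.i_subspaces 1. P \<subseteq> W}) ` ?S)"
        using P line_mem_spread[OF v(2)] by blast
    qed auto
    show "disjoint ((\<lambda>W. {P \<in> G.i_subspaces 1. P \<subseteq> W}) ` ?S)"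
    proof (rule disjointI)
      fix A B assume AB: "A \<in> (\<lambda>W. {P \<in> G.i_subspaces 1. P \<subseteq> W}) ` ?S"
        "B \<in> (\<lambda>W. {P \<in> G.i_subspaces 1. P \<subseteq> W}) ` ?S" "A \<noteq> B"
      then obtain W W' where W: "W \<in> ?S" "A = {P \<in> G.i_subspaces 1. P \<subseteq> W}"
        "W' \<in> ?S" "B = {P \<in> G.i_subspaces 1. P \<subseteq> W'}" by blast
      show "A \<inter> B = {}"
      proof (rule ccontr)
        assume "A \<inter> B \<noteq> {}"
        then obtain P where P: "P \<in> G.i_subspaces 1" "P \<subseteq> W" "P \<subseteq> W'" using W by blast
        then obtain v where "v \<in> P" "v \<noteq> 0" using point_nonzero by blast
        then have "W = W'" using spread_disjoint[OF W(1,3)] P by blast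
        then show False using W AB(3) by simp
      qed
    qed
    show "{} \<notin> (\<lambda>W. {P \<in> G.i_subspaces 1. P \<subseteq> W}) ` ?S"
    proof
      assume "{} \<in> (\<lambda>W. {P \<in> G.i_subspaces 1. P \<subseteq> W}) ` ?S"
      then obtain W where W: "W \<in> ?S" "{P \<in> G.i_subspaces 1. P \<subseteq> W} = {}" by blast
      obtain v where v: "v \<in> W" "v \<noteq> 0" using W(1) by (rule spread_ex_nonzero)
      have "(\<lambda>e. e *s v) ` ?E \<subseteq> W" using spread_eq_line[OF W(1) v] by auto
      then show False using W(2) point[OF v(2)] by blast
    qed
  qed

  have meet: "G.dim (B \<inter> W) \<le> 1" if B: "B \<in> V.blocks" and W: "W \<in> ?S" for B W
  proof -
    have sub: "V.E_subspace (B \<inter> W)"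
      using V.blocks_E_subspace[OF B] spread_E[OF W] by (auto simp: V.E_subspace_def)
    have "card (B \<inter> W) \<le> q"
    proof (cases "\<exists>v\<in>B \<inter> W. v \<noteq> 0")
      case True
      then obtain v where v: "v \<in> B" "v \<in> W" "v \<noteq> 0" by blast
      \<comment> \<open>W is the line through v, so every y in the intersection is c v for a field
        element c, and two such vectors in one block force c into \<open>?E\<close>.\<close>
      have "B \<inter> W \<subseteq> (\<lambda>e. e *s v) ` ?E"
      proof
        fix y assume y: "y \<in> B \<inter> W"
        then obtain c where c: "y = c *s v" using spread_eq_line[OF W v(2,3)] by auto
        then have "c \<in> ?E" using V.blocks_scattered[OF B v(1,3)] y by blast
        then show "y \<in> (\<lambda>e. e *s v) ` ?E" using c by blast
      qed
      then show ?thesis using card_line[OF v(3), of ?E] cardE card_mono[of "(\<lambda>e. e *s v) ` ?E"] by simp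
    next
      case False
      then have "B \<inter> W \<subseteq> {0}" by blast
      then have "card (B \<inter> W) \<le> card {0 :: 'f ^ 'm}" by (rule card_mono[rotated]) simp
      then show ?thesis using q1 by simp
    qed
    then show ?thesis
      using G.dim_le_iff_card[of "B \<inter> W" 1] sub G_subspace assms(2) by simp
  qed

  define N where "N T = card {B \<in> V.blocks. T \<subseteq> B}" for T
  let ?lam = "(\<Sum>r = 2..k - 1. \<Sum>u | u dvd gcd (r + 1) l.
          of_int (wr r u) *
          ((real q ^ k - 1) * (real q ^ k - real q) *
             (\<Prod>j = 2..k - 2. real q ^ (m * l) - real q ^ (j * l)) /
           ((real q ^ u - 1) * (\<Prod>j = r + 1..k - 1. real q ^ k - real q ^ j)))) +
       of_int w * real q ^ ((l - 1) * ((k choose 2) - 1)) *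
         (\<Prod>j = 2..k - 1. (real q ^ ((m - j) * l) - 1) / (real q ^ (k - j) - 1))"
  have N: "real (N (V.span_of {0, 1} x)) = ?lam" if x: "V.full.indep {0, 1} x" for x :: "nat \<Rightarrow> 'f ^ 'm"
  proof -
    let ?D = "\<Prod>j=2..<k. real q ^ k - real q ^ j"
    let ?R = "\<Prod>j=2..<k - 1. real (q ^ l) ^ m - real (q ^ l) ^ j"
    have "real (q ^ l) - 1 \<noteq> 0"
      using one_less_power[OF q1 assms(7)] by linarith
    have ivl: "{2..k - 2} = {2..<k - 1}" using k3 by auto
    have R: "(\<Prod>j = 2..k - 2. real q ^ (m * l) - real q ^ (j * l)) = ?R"
      unfolding ivl by (simp add: mult.commute flip: power_mult)
    have "real (N (V.span_of {0, 1} x)) =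
        ((if w = 1 then \<Prod>j=2..<k. real (q ^ l) ^ m - real (q ^ l) ^ j else 0) +
         (\<Sum>U\<in>C. qfall q k (\<delta> U)) / (real (q ^ l) - 1) * ?R) / ?D"
      using V.card_blocks_containing[OF x card_V m2, of \<delta>] C(2)
      unfolding N_def cardE assms(3) by simp
    also have "\<dots> = (if w = 1 then (\<Prod>j=2..<k. real (q ^ l) ^ m - real (q ^ l) ^ j) / ?D else 0) +
        (\<Sum>U\<in>C. qfall q k (\<delta> U)) * (?R / (real (q ^ l) - 1) / ?D)"
      by (simp add: add_divide_distrib)
    also have "(if w = 1 then (\<Prod>j=2..<k. real (q ^ l) ^ m - real (q ^ l) ^ j) / ?D else 0) =
        of_int w * real q ^ ((l - 1) * ((k choose 2) - 1)) *
         (\<Prod>j = 2..k - 1. (real q ^ ((m - j) * l) - 1) / (real q ^ (k - j) - 1))"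
      using prod_independent_quotient[OF q1 assms(7), of k m] km k3 assms(10) by auto
    also have "(\<Sum>U\<in>C. qfall q k (\<delta> U)) * (?R / (real (q ^ l) - 1) / ?D) =
      (\<Sum>r = 2..k - 1. \<Sum>u | u dvd gcd (r + 1) l.
          of_int (wr r u) *
          ((real q ^ k - 1) * (real q ^ k - real q) *
             (\<Prod>j = 2..k - 2. real q ^ (m * l) - real q ^ (j * l)) /
           ((real q ^ u - 1) * (\<Prod>j = r + 1..k - 1. real q ^ k - real q ^ j))))"
      unfolding C_sum sum_distrib_right R
    proof (intro sum.cong refl)
      fix r u assume r: "r \<in> {2..k - 1}"
      let ?P = "\<Prod>j = r + 1..k - 1. real q ^ k - real q ^ j"
      have quot: "qfall q k (r + 1) / ?D = (real q ^ k - 1) * (real q ^ k - real q) / ?P"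
        using qfall_quotient[OF q1, of r k] r k3 by auto
      \<comment> \<open>Here c is q^l - 1: the numerator of the orbit size cancels against the
        number of generators per tuple.\<close>
      have "a * (c / b) * f * (R / c / D) = a * (N * R / (b * P))" if "c \<noteq> 0" "f / D = N / P"
        for a b c f D N P R :: real
      proof -
        have "a * (c / b) * f * (R / c / D) = a * (f / D) * R / b"
          using that(1) by (simp add: mult_ac)
        also have "\<dots> = a * (N * R / (b * P))" unfolding that(2) by (simp add: mult_ac)
        finally show ?thesis .
      qed
      from this[OF \<open>real (q ^ l) - 1 \<noteq> 0\<close> quot]
      show "of_int (wr r u) * ((real q ^ l - 1) / (real q ^ u - 1)) * qfall q k (r + 1) *
          (?R / (real (q ^ l) - 1) / ?D) =
        of_int (wr r u) * ((real q ^ k - 1) * (real q ^ k - real q) * ?R /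
          ((real q ^ u - 1) * ?P))" by (simp only: of_nat_power)
    qed
    finally show ?thesis by (simp only: add.commute)
  qed

  \<comment> \<open>One fixed pair, available since m >= 2, provides \<open>lam\<close> as a natural
    number; \<open>N\<close> knows its real value and shows that every other pair gives the
    same.\<close>
  obtain x0 :: "nat \<Rightarrow> 'f ^ 'm" where x0: "V.full.indep {0, 1} x0"
    using V.full.ex_indep_extension[OF V.full.E_subspace_UNIV card_V, of "{}" undefined "{0, 1::nat}"] m2
    by auto
  let ?lam' = "N (V.span_of {0, 1} x0)"

  have cover: "N T = ?lam'" if T: "T \<in> G.i_subspaces 2" "\<forall>W\<in>?S. \<not> T \<subseteq> W" for T
  proof -
    have T': "V.E_subspace T" "card T = card ?E ^ 2" using T(1) cardE by (auto simp: G_i)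
    obtain x :: "nat \<Rightarrow> 'f ^ 'm" where x: "x \<in> {0, 1} \<rightarrow> T" "V.indep {0, 1} x"
      using V.ex_indep_extension[OF T', of "{}" undefined "{0, 1::nat}"] by auto
    have span: "V.span_of {0, 1} x = T"
      using x T' by (intro V.span_of_subspace_eq) (auto simp: V.card_span_of power2_eq_square)
    have x0_nonzero: "x 0 \<noteq> 0"
      using x(2) V.indep_insert[of "{1}" 0 x] V.E_subspace_span_of[of "{1}" x]
      by (auto simp: V.E_subspace_def insert_commute)
    \<comment> \<open>A dependence over the large field would put T inside the line through
      \<open>x 0\<close>, which is a group.\<close>
    have "V.full.indep {0, 1} x"
    proof (rule ccontr)
      assume "\<not> ?thesis"
      moreover have "V.full.indep {0} x"
        using x0_nonzero V.full.indep_insert[of "{}" 0 x] by simp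
      ultimately have "x 1 \<in> V.full.span_of {0} x"
        using V.full.indep_insert[of "{0}" 1 x] by (simp add: insert_commute)
      then obtain c where c: "x 1 = c *s x 0"
        by (auto simp: V.full.span_of_def V.full.comb_def)
      have "T \<subseteq> range (\<lambda>c. c *s x 0)"
      proof -
        have line: "V.E_subspace (range (\<lambda>c. c *s x 0))"
          by (rule spread_E[OF line_mem_spread[OF x0_nonzero]])
        have "x 0 = 1 *s x 0" by simp
        then have "x \<in> {0, 1} \<rightarrow> range (\<lambda>c. c *s x 0)" using c by blast
        then show ?thesis using V.span_of_minimal[OF line] span by blast
      qed
      then show False using T(2) line_mem_spread[OF x0_nonzero] by blast
    qed
    then have "real (N T) = real ?lam'"
      using trans[OF N[of x] N[OF x0, symmetric]] unfolding span by blast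
    then show ?thesis by simp
  qed

  \<comment> \<open>Each block receives multiplicity one, so the design is simple by
    construction.\<close>
  let ?B = "mset_set V.blocks"
  have "G.q_gdd q (m * l) l k ?lam' ?S ?B"
    unfolding G.q_gdd_def
  proof (intro conjI ballI impI)
    show "G.dim (UNIV :: ('f ^ 'm) set) = m * l"
      using G.dim_eq_iff_card[OF G.subspace_UNIV] assms(2,3) card_V
      by (simp add: mult.commute flip: power_mult)
    show "?S \<subseteq> G.i_subspaces l"
      using spread_E assms(3) by (auto simp: G_i desarguesian_spread_iff)
    show "set_mset ?B \<subseteq> G.i_subspaces k"
      using V.blocks_E_subspace V.card_block cardE by (auto simp: G_i)
    show "G.dim (B \<inter> W) \<le> 1" if "W \<in> ?S" "B \<in># ?B" for W B
      using that by (intro meet) auto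
    show "size {#B \<in># ?B. T \<subseteq> B#} = ?lam'" if "T \<in> G.i_subspaces 2" "\<forall>W\<in>?S. \<not> T \<subseteq> W" for T
      using cover[OF that] by (simp add: N_def)
  qed (use assms(2) partition in auto)
  moreover have "simple_blocks ?B"
    by (auto simp: simple_blocks_def count_mset_set')
  moreover have "G.admits_automorphism_group GL_action ?S ?B"
    unfolding G.admits_automorphism_group_def
  proof (intro conjI ballI)
    show "GL_action \<subseteq> G.GL_maps"
    proof
      fix f :: "'f ^ 'm \<Rightarrow> 'f ^ 'm" assume f: "f \<in> GL_action"
      have "Vector_Spaces.linear (restricted_scale h) (restricted_scale h) f"
        using GL_action_linear(2,3)[OF f] G.vector_space_axioms
        by (simp add: Vector_Spaces.linear_iff restricted_scale_def)
      then show "f \<in> G.GL_maps"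
        using GL_action_linear(1)[OF f] by (simp add: G.GL_maps_def)
    qed
    fix f :: "'f ^ 'm \<Rightarrow> 'f ^ 'm" assume f: "f \<in> GL_action"
    have inj: "inj f" using GL_action_linear(1)[OF f] by (rule bij_is_inj)
    have injB: "inj_on ((`) f) V.blocks"
      using inj by (auto simp: inj_on_def inj_image_eq_iff)
    have "(`) f ` V.blocks = V.blocks"
    proof (rule card_subset_eq)
      show "(`) f ` V.blocks \<subseteq> V.blocks"
        using V.blocks_image[OF _ inj] GL_action_linear(2,3)[OF f] by blast
      show "card ((`) f ` V.blocks) = card V.blocks" by (rule card_image[OF injB])
    qed simp
    then show "image_mset ((`) f) ?B = ?B" by (simp add: image_mset_mset_set[OF injB])
    show "(`) f ` ?S = ?S" by (rule GL_action_spread[OF f])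
  qed (auto intro: GL_action_group)
  ultimately show ?thesis using N[OF x0] by blast
qed

end
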